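(* Let $V$ be a pure odd real vector space of finite dimension $m$ with a symmetric (in the ordinary sense) positive definite bilinear form $(\,,)$, and fix an orthonormal basis $e_1,\ldots,e_m$ of $V$. Let $\mu\in S^*V$ be a real metric $L_\infty$-algebra structure on $V$, i.e. an odd element of $S^*V$ with $[\mu,\mu]\in S^0V=\mathbb R$. Write $\mu=\sum_k\mu_k$ with $\mu_k\in S^{k+2}V$, and define linear operators on $S^*V$ by $$d=[\mu,-],\qquad d_k=[\mu_k,-],\qquad \delta=\sum_k(-1)^{\frac{k(1-k)}{2}}\,{*}\,d_k\,{*},\qquad \mathcal L=\delta\circ d+d\circ\delta .$$ Then there is a direct sum decomposition $$S^*V=\operatorname{Im}(d)\oplus\operatorname{Im}(\delta)\oplus\operatorname{Ker}(\mathcal L),$$ and $\operatorname{Ker}(\mathcal L)\simeq H(V,\mu)$, where $H(V,\mu)=\operatorname{Ker}(d)/\operatorname{Im}(d)$.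
   Context: Since $V$ is pure odd, $S^pV$ denotes the super-symmetric power, i.e. the ordinary exterior power $\bigwedge^pV$; elements of $S^pV$ have parity $p \bmod 2$; $S^*V=\bigoplus_{p=0}^mS^pV$ with $S^0V=\mathbb R$. The Poisson bracket $[\,,]$ on $S^*V$ is the bilinear operation, zero when one argument is a scalar, determined by $[x,y]=(x,y)$ for $x,y\in V$, $[v,w_1w_2]=[v,w_1]w_2+(-1)^{pq}w_1[v,w_2]$ for $v\in S^pV$, $w_1\in S^qV$, $w_2\in S^*V$, and $[v,w]=-(-1)^{pq}[w,v]$ for $v\in S^pV$, $w\in S^qV$. With $L=e_1e_2\cdots e_m\in S^mV$, the operator $*:S^pV\to S^{m-p}V$ is the linear map with $*(x_1\cdots x_p)=[x_1,[\ldots,[x_p,L]\ldots]]$ for $x_1,\ldots,x_p\in V$ (and $*(1)=L$). *)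

theory Defs
  imports "HOL-Analysis.Analysis" "HOL-Library.Poly_Mapping"
begin

section \<open>The exterior algebra of a real vector space\<close>

text \<open>The exterior algebra is the free unital associative algebra on the set \<open>V\<close>
  (finitely supported functions on words), modulo the two-sided ideal that makes
  \<open>V\<close> embed linearly and its elements square to zero; that is, the tensor algebra
  modulo all \<open>x \<otimes> x\<close>.\<close>

datatype 'v free_monoid = Letters (letters: "'v list")

instantiation free_monoid :: (type) monoid_add
begin
definition zero_free_monoid :: "'a free_monoid" where "0 = Letters []"
definition plus_free_monoid :: "'a free_monoid \<Rightarrow> 'a free_monoid \<Rightarrow> 'a free_monoid"
  where "u + w = Letters (letters u @ letters w)"
instance by standard (auto simp: zero_free_monoid_def plus_free_monoid_def)
end

type_synonym 'v free_alg = "'v free_monoid \<Rightarrow>\<^sub>0 real"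

definition free_gen :: "'v \<Rightarrow> 'v free_alg"
  where "free_gen x = Poly_Mapping.single (Letters [x]) 1"

definition free_const :: "real \<Rightarrow> 'v free_alg"
  where "free_const c = Poly_Mapping.single 0 c"

inductive_set ext_relators :: "('v::real_vector) free_alg set" where
  add: "free_gen (x + y) - free_gen x - free_gen y \<in> ext_relators"
| scale: "free_gen (c *\<^sub>R x) - free_const c * free_gen x \<in> ext_relators"
| square: "free_gen x * free_gen x \<in> ext_relators"

inductive_set ext_ideal :: "('v::real_vector) free_alg set" where
  zero: "0 \<in> ext_ideal"
| step: "r \<in> ext_relators \<Longrightarrow> i \<in> ext_ideal \<Longrightarrow> a * r * b + i \<in> ext_ideal"

lemma ext_ideal_add: "p \<in> ext_ideal \<Longrightarrow> q \<in> ext_ideal \<Longrightarrow> p + q \<in> ext_ideal"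
  by (induction p rule: ext_ideal.induct) (auto simp: add.assoc intro: ext_ideal.step)

lemma ext_ideal_mult_left: "p \<in> ext_ideal \<Longrightarrow> c * p \<in> ext_ideal"
proof (induction p rule: ext_ideal.induct)
  case (step r i a b)
  then show ?case using ext_ideal.step[of r "c * i" "c * a" b] by (simp add: algebra_simps)
qed (auto intro: ext_ideal.zero)

lemma ext_ideal_mult_right: "p \<in> ext_ideal \<Longrightarrow> p * c \<in> ext_ideal"
proof (induction p rule: ext_ideal.induct)
  case (step r i a b)
  then show ?case using ext_ideal.step[of r "i * c" a "b * c"] by (simp add: algebra_simps)
qed (auto intro: ext_ideal.zero)

lemma ext_ideal_uminus: "p \<in> ext_ideal \<Longrightarrow> - p \<in> ext_ideal"
  using ext_ideal_mult_left[of p "-1"] by simp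

lemma ext_ideal_relator: "r \<in> ext_relators \<Longrightarrow> r \<in> ext_ideal"
  using ext_ideal.step[of r 0 1 1] ext_ideal.zero by simp

definition ext_rel :: "('v::real_vector) free_alg \<Rightarrow> 'v free_alg \<Rightarrow> bool"
  where "ext_rel p q \<longleftrightarrow> p - q \<in> ext_ideal"

quotient_type (overloaded) 'v exterior = "('v::real_vector) free_alg" / ext_rel
proof (rule equivpI)
  show "reflp ext_rel" by (simp add: reflp_def ext_rel_def ext_ideal.zero)
  show "symp ext_rel"
    unfolding symp_def ext_rel_def using ext_ideal_uminus by (metis minus_diff_eq)
  show "transp ext_rel"
  proof (rule transpI)
    fix p q r :: "'a free_alg"
    assume "ext_rel p q" "ext_rel q r"
    then show "ext_rel p r"
      using ext_ideal_add[of "p - q" "q - r"] by (simp add: ext_rel_def)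
  qed
qed


lemma single_conv_const:
  "Poly_Mapping.single w c = free_const c * Poly_Mapping.single (w :: 'v free_monoid) 1"
  by (simp add: free_const_def mult_single)

lemma free_alg_induct [case_names zero step]:
  fixes p :: "'v free_alg"
  assumes "P 0" "\<And>w c p. P p \<Longrightarrow> P (Poly_Mapping.single w c + p)"
  shows "P p"
proof (induction p rule: update_induct)
  case (update f a b)
  have "Poly_Mapping.update a b f = Poly_Mapping.single a b + f"
    by (rule poly_mapping_eqI)
       (use update in \<open>auto simp: lookup_update lookup_add lookup_single in_keys_iff when_def\<close>)
  then show ?case using assms(2) update by simp
qed (rule assms(1))

lemma free_const_central: "free_const c * p = p * free_const c"
  by (induction p rule: free_alg_induct)
     (simp_all add: algebra_simps free_const_def mult_single)

lemma free_const_mult: "free_const (c * d) = free_const c * free_const d"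
  by (simp add: free_const_def mult_single)

lemma free_const_add: "free_const (c + d) = free_const c + free_const d"
  by (simp add: free_const_def single_add)

lemma free_const_1: "free_const 1 = 1"
  by (simp add: free_const_def)

text \<open>The free algebra acts on any module on which \<open>V\<close> acts linearly.\<close>

definition free_act :: "('v \<Rightarrow> 'b \<Rightarrow> 'b) \<Rightarrow> 'v free_alg \<Rightarrow> 'b \<Rightarrow> 'b::real_vector"
  where "free_act f p b = (\<Sum>w\<in>Poly_Mapping.keys p. Poly_Mapping.lookup p w *\<^sub>R foldr f (letters w) b)"

lemma free_act_superset:
  assumes "finite A" "Poly_Mapping.keys p \<subseteq> A"
  shows "free_act f p b = (\<Sum>w\<in>A. Poly_Mapping.lookup p w *\<^sub>R foldr f (letters w) b)"
  unfolding free_act_def using assms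
  by (intro sum.mono_neutral_left) (auto simp: in_keys_iff)

lemma free_act_zero: "free_act f 0 b = 0"
  by (simp add: free_act_def)

lemma free_act_add: "free_act f (p + q) b = free_act f p b + free_act f q b"
proof -
  let ?A = "Poly_Mapping.keys p \<union> Poly_Mapping.keys q"
  have "Poly_Mapping.keys (p + q) \<subseteq> ?A" by (rule Poly_Mapping.keys_add)
  then show ?thesis
    by (simp add: free_act_superset[of ?A] lookup_add scaleR_add_left sum.distrib)
qed

lemma free_act_single: "free_act f (Poly_Mapping.single w c) b = c *\<^sub>R foldr f (letters w) b"
  by (cases "c = 0") (simp_all add: free_act_def)

lemma free_act_uminus: "free_act f (- p) b = - free_act f p b"
  using free_act_add[of f p "- p" b] by (simp add: free_act_zero eq_neg_iff_add_eq_0 add.commute)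

lemma free_act_diff: "free_act f (p - q) b = free_act f p b - free_act f q b"
  using free_act_add[of f p "- q" b] by (simp add: free_act_uminus)

lemma linear_foldr: "(\<And>x. linear (f x)) \<Longrightarrow> linear (foldr f xs)"
  by (induction xs) (auto simp: linear_compose id_def[symmetric] linear_id)

lemma free_act_linear:
  assumes "\<And>x. linear (f x)"
  shows "linear (free_act f p)"
  unfolding free_act_def
  by (intro linear_compose_sum ballI linear_compose_scale_right) (simp add: linear_foldr assms)

lemma free_act_mult:
  assumes "\<And>x. linear (f x)"
  shows "free_act f (p * q) b = free_act f p (free_act f q b)"
proof (induction p rule: free_alg_induct)
  case (step w c p)
  have "free_act f (Poly_Mapping.single w c * q) b
      = free_act f (Poly_Mapping.single w c) (free_act f q b)"
  proof (induction q rule: free_alg_induct)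
    case (step u d q)
    then show ?case
      using linear_foldr[of f "letters w", OF assms]
      by (simp add: algebra_simps free_act_add free_act_single mult_single
          plus_free_monoid_def linear_add linear_cmul)
  qed (simp add: free_act_zero linear_0[OF free_act_linear[OF assms]])
  then show ?case by (simp add: free_act_add step algebra_simps)
qed (simp add: free_act_zero)

lemma free_act_const: "free_act f (free_const c) b = c *\<^sub>R b"
  by (simp add: free_const_def free_act_single zero_free_monoid_def)

lemma free_act_gen: "free_act f (free_gen x) b = f x b"
  by (simp add: free_gen_def free_act_single)

locale ext_action =
  fixes f :: "'v::real_vector \<Rightarrow> 'b \<Rightarrow> 'b::real_vector"
  assumes lin1: "\<And>b. linear (\<lambda>x. f x b)"
    and lin2: "\<And>x. linear (f x)"
    and square: "\<And>x b. f x (f x b) = 0"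
begin

lemma relator: "r \<in> ext_relators \<Longrightarrow> free_act f r b = 0"
  by (induction rule: ext_relators.induct)
     (simp_all add: free_act_diff free_act_gen free_act_mult lin2 free_act_const
        linear_add[OF lin1] linear_cmul[OF lin1] square)

lemma ideal: "p \<in> ext_ideal \<Longrightarrow> free_act f p b = 0"
  by (induction rule: ext_ideal.induct)
     (simp_all add: free_act_zero free_act_add free_act_mult lin2 relator
        linear_0[OF free_act_linear[OF lin2]])

end

lemma one_not_in_ext_ideal: "(1 :: 'v::real_vector free_alg) \<notin> ext_ideal"
proof -
  interpret ext_action "\<lambda>(x::'v) (b::real). 0"
    by standard (auto simp: linear_iff)
  show ?thesis using ideal[of 1 1] free_act_const[of "\<lambda>(x::'v) (b::real). 0" 1 1] by (auto simp: free_const_1)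
qed

instantiation exterior :: (real_vector) real_algebra_1
begin

lift_definition zero_exterior :: "'a exterior" is 0 .
lift_definition one_exterior :: "'a exterior" is 1 .
lift_definition plus_exterior :: "'a exterior \<Rightarrow> 'a exterior \<Rightarrow> 'a exterior" is "(+)"
proof -
  fix p p' q q' :: "'a free_alg"
  assume "ext_rel p p'" "ext_rel q q'"
  then show "ext_rel (p + q) (p' + q')"
    unfolding ext_rel_def add_diff_add by (rule ext_ideal_add)
qed
lift_definition uminus_exterior :: "'a exterior \<Rightarrow> 'a exterior" is uminus
proof -
  fix p p' :: "'a free_alg"
  assume "ext_rel p p'"
  then show "ext_rel (- p) (- p')"
    using ext_ideal_uminus[of "p - p'"] by (simp add: ext_rel_def)
qed
lift_definition minus_exterior :: "'a exterior \<Rightarrow> 'a exterior \<Rightarrow> 'a exterior" is "(-)"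
proof -
  fix p p' q q' :: "'a free_alg"
  assume "ext_rel p p'" "ext_rel q q'"
  moreover have "p - q - (p' - q') = (p - p') + - (q - q')" by simp
  ultimately show "ext_rel (p - q) (p' - q')"
    unfolding ext_rel_def by (simp only: ext_ideal_add ext_ideal_uminus)
qed
lift_definition times_exterior :: "'a exterior \<Rightarrow> 'a exterior \<Rightarrow> 'a exterior" is "(*)"
proof -
  fix p p' q q' :: "'a free_alg"
  assume "ext_rel p p'" "ext_rel q q'"
  moreover have "p * q - p' * q' = (p - p') * q + p' * (q - q')" by (simp add: algebra_simps)
  ultimately show "ext_rel (p * q) (p' * q')"
    unfolding ext_rel_def by (simp only: ext_ideal_add ext_ideal_mult_left ext_ideal_mult_right)
qed
lift_definition scaleR_exterior :: "real \<Rightarrow> 'a exterior \<Rightarrow> 'a exterior" is "\<lambda>c p. free_const c * p"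
  unfolding ext_rel_def right_diff_distrib[symmetric] by (rule ext_ideal_mult_left)

instance
proof
  note refl = ext_rel_def ext_ideal.zero
  fix a b c :: "'a exterior" and r s :: real
  show "a + b + c = a + (b + c)" by transfer (simp add: refl add.assoc)
  show "a + b = b + a" by transfer (simp add: refl add.commute)
  show "0 + a = a" by transfer (simp add: refl)
  show "- a + a = 0" by transfer (simp add: refl)
  show "a - b = a + - b" by transfer (simp add: refl)
  show "a * b * c = a * (b * c)" by transfer (simp add: refl mult.assoc)
  show "(a + b) * c = a * c + b * c" by transfer (simp add: refl algebra_simps)
  show "a * (b + c) = a * b + a * c" by transfer (simp add: refl algebra_simps)
  show "1 * a = a" by transfer (simp add: refl)
  show "a * 1 = a" by transfer (simp add: refl)
  show "(0 :: 'a exterior) \<noteq> 1"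
    by transfer (use one_not_in_ext_ideal ext_ideal_uminus in \<open>fastforce simp: ext_rel_def\<close>)
  show "r *\<^sub>R (a + b) = r *\<^sub>R a + r *\<^sub>R b" by transfer (simp add: refl algebra_simps)
  show "(r + s) *\<^sub>R a = r *\<^sub>R a + s *\<^sub>R a" by transfer (simp add: refl algebra_simps free_const_add)
  show "r *\<^sub>R s *\<^sub>R a = (r * s) *\<^sub>R a" by transfer (simp add: refl free_const_mult mult.assoc)
  show "1 *\<^sub>R a = a" by transfer (simp add: refl free_const_1)
  show "r *\<^sub>R a * b = r *\<^sub>R (a * b)" by transfer (simp add: refl mult.assoc)
  show "a * r *\<^sub>R b = r *\<^sub>R (a * b)"
  proof transfer
    fix r and p q :: "'a free_alg"
    have "p * (free_const r * q) = free_const r * (p * q)" by (metis free_const_central mult.assoc)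
    then show "ext_rel (p * (free_const r * q)) (free_const r * (p * q))" by (simp add: refl)
  qed
qed

end

lift_definition ext_inc :: "'v::real_vector \<Rightarrow> 'v exterior" is free_gen .

lemma ext_inc_add: "ext_inc (x + y) = ext_inc x + ext_inc y"
  by transfer (use ext_ideal_relator[OF ext_relators.add] in \<open>simp add: ext_rel_def diff_diff_eq\<close>)

lemma ext_inc_scale: "ext_inc (c *\<^sub>R x) = c *\<^sub>R ext_inc x"
  by transfer (use ext_ideal_relator[OF ext_relators.scale] in \<open>simp add: ext_rel_def\<close>)

lemma linear_ext_inc: "linear ext_inc"
  by (simp add: linear_iff ext_inc_add ext_inc_scale)

lemma ext_inc_square: "ext_inc x * ext_inc x = 0"
  by transfer (use ext_ideal_relator[OF ext_relators.square] in \<open>simp add: ext_rel_def\<close>)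

lemma exterior_induct [case_names one mult add scale]:
  fixes w :: "'v::real_vector exterior"
  assumes one: "P 1"
    and mult: "\<And>x w. P w \<Longrightarrow> P (ext_inc x * w)"
    and add: "\<And>v w. P v \<Longrightarrow> P w \<Longrightarrow> P (v + w)"
    and scale: "\<And>c w. P w \<Longrightarrow> P (c *\<^sub>R w)"
  shows "P w"
proof -
  have word: "P (abs_exterior (Poly_Mapping.single (Letters xs) 1))" for xs
  proof (induction xs)
    case Nil
    then show ?case using one by (simp add: one_exterior_def zero_free_monoid_def[symmetric])
  next
    case (Cons x xs)
    have "ext_inc x * abs_exterior (Poly_Mapping.single (Letters xs) 1)
        = abs_exterior (Poly_Mapping.single (Letters (x # xs)) 1)"
      by (simp add: ext_inc.abs_eq times_exterior.abs_eq free_gen_def mult_single plus_free_monoid_def)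
    then show ?case using mult[OF Cons, of x] by metis
  qed
  have "P (abs_exterior p)" for p
  proof (induction p rule: free_alg_induct)
    case zero
    then show ?case using scale[OF one, of 0] by (simp add: zero_exterior_def)
  next
    case (step w c p)
    have "abs_exterior (Poly_Mapping.single w c + p)
        = c *\<^sub>R abs_exterior (Poly_Mapping.single w 1) + abs_exterior p"
      by (simp add: plus_exterior.abs_eq scaleR_exterior.abs_eq free_const_def mult_single)
    moreover have "P (abs_exterior (Poly_Mapping.single w 1))"
      using word by (cases w) simp
    ultimately show ?case using add scale step by metis
  qed
  from this[of "rep_exterior w"] show ?thesis
    unfolding Quotient_abs_rep[OF Quotient_exterior] .
qed

lemma (in ext_action) ext_act_exists:
  "\<exists>F. bilinear F \<and> (\<forall>b. F 1 b = b) \<and> (\<forall>x w b. F (ext_inc x * w) b = f x (F w b))"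
proof -
  have resp: "free_act f p b = free_act f q b" if "ext_rel p q" for p q b
    using ideal[of "p - q" b] that unfolding ext_rel_def free_act_diff by (metis eq_iff_diff_eq_0)
  define F where "F w b = free_act f (rep_exterior w) b" for w b
  have F_abs: "F (abs_exterior p) b = free_act f p b" for p b
    unfolding F_def
    by (rule resp) (simp add: exterior.abs_eq_iff[symmetric] Quotient_abs_rep[OF Quotient_exterior])
  have abs: "\<exists>p. w = abs_exterior p" for w :: "'v exterior"
    by (metis Quotient_abs_rep[OF Quotient_exterior])
  have "F (v + w) b = F v b + F w b" for v w b
    using abs[of v] abs[of w] by (auto simp: plus_exterior.abs_eq F_abs free_act_add)
  moreover have "F (c *\<^sub>R v) b = c *\<^sub>R F v b" for c v b
    using abs[of v] by (auto simp: scaleR_exterior.abs_eq F_abs free_act_mult lin2 free_act_const)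
  moreover have "linear (F w)" for w
    unfolding F_def using free_act_linear[of f, OF lin2] by simp
  ultimately have "bilinear F"
    by (simp add: bilinear_def linear_iff)
  moreover have "F 1 b = b" for b
    using free_act_const[of f 1 b] by (simp add: one_exterior_def F_abs free_const_1)
  moreover have "F (ext_inc x * w) b = f x (F w b)" for x w b
    using abs[of w]
    by (auto simp: ext_inc.abs_eq times_exterior.abs_eq F_abs free_act_mult lin2 free_act_gen)
  ultimately show ?thesis by blast
qed

definition ext_power :: "nat \<Rightarrow> ('v::real_vector) exterior set"
  where "ext_power p = span {prod_list (map ext_inc xs) | xs. length xs = p}"

definition ext_odd :: "('v::real_vector) exterior set"
  where "ext_odd = span (\<Union>p\<in>{p. odd p}. ext_power p)"

section \<open>The Poisson bracket and the star operator\<close>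

text \<open>Both are definite descriptions; existence and uniqueness are proved below for every
  bilinear form that has an orthonormal basis.\<close>

definition is_poisson_bracket ::
  "('v::real_vector \<Rightarrow> 'v \<Rightarrow> real) \<Rightarrow> ('v exterior \<Rightarrow> 'v exterior \<Rightarrow> 'v exterior) \<Rightarrow> bool"
  where "is_poisson_bracket B P \<longleftrightarrow>
    bilinear P \<and>
    (\<forall>c w. P (of_real c) w = 0 \<and> P w (of_real c) = 0) \<and>
    (\<forall>x y. P (ext_inc x) (ext_inc y) = of_real (B x y)) \<and>
    (\<forall>p q. \<forall>v\<in>ext_power p. \<forall>w1\<in>ext_power q. \<forall>w2.
      P v (w1 * w2) = P v w1 * w2 + (-1) ^ (p * q) * w1 * P v w2) \<and>
    (\<forall>p q. \<forall>v\<in>ext_power p. \<forall>w\<in>ext_power q. P v w = - ((-1) ^ (p * q) * P w v))"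

definition poisson_bracket ::
  "('v::real_vector \<Rightarrow> 'v \<Rightarrow> real) \<Rightarrow> 'v exterior \<Rightarrow> 'v exterior \<Rightarrow> 'v exterior"
  where "poisson_bracket B = (THE P. is_poisson_bracket B P)"

definition orthonormal_basis ::
  "('v::real_vector \<Rightarrow> 'v \<Rightarrow> real) \<Rightarrow> nat \<Rightarrow> (nat \<Rightarrow> 'v) \<Rightarrow> bool"
  where "orthonormal_basis B m e \<longleftrightarrow>
    (\<forall>i\<in>{1..m}. \<forall>j\<in>{1..m}. B (e i) (e j) = (if i = j then 1 else 0)) \<and>
    span (e ` {1..m}) = UNIV"

lemma prod_mem_power:
  assumes "length xs = p"
  shows "prod_list (map ext_inc xs) \<in> ext_power p"
  unfolding ext_power_def by (intro span_base CollectI exI conjI, rule refl, rule assms)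

lemma ext_inc_mem_power: "ext_inc x \<in> ext_power 1"
  using prod_mem_power[of "[x]" 1] by simp

lemma one_mem_power: "1 \<in> ext_power 0"
  using prod_mem_power[of "[]" 0] by simp

lemma subspace_ext_power: "subspace (ext_power p)"
  unfolding ext_power_def by (rule subspace_span)

lemma ext_power_induct [consumes 1, case_names zero add scale gen]:
  assumes "w \<in> ext_power p" "P 0" "\<And>v w. P v \<Longrightarrow> P w \<Longrightarrow> P (v + w)"
    "\<And>c w. P w \<Longrightarrow> P (c *\<^sub>R w)" "\<And>xs. length xs = p \<Longrightarrow> P (prod_list (map ext_inc xs))"
  shows "P w"
proof -
  have "subspace {w. P w}" unfolding subspace_def using assms(2-4) by blast
  moreover have "{prod_list (map ext_inc xs) | xs. length xs = p} \<subseteq> {w. P w}" using assms(5) by blast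
  ultimately have "ext_power p \<subseteq> {w. P w}" unfolding ext_power_def by (rule span_minimal[rotated])
  then show ?thesis using assms(1) by blast
qed

lemma ext_inc_mult_power: "w \<in> ext_power p \<Longrightarrow> ext_inc x * w \<in> ext_power (Suc p)"
proof (induction rule: ext_power_induct)
  case (gen xs)
  then show ?case using prod_mem_power[of "x # xs" "Suc p"] by simp
qed (simp_all add: subspace_0 subspace_add subspace_scale subspace_ext_power distrib_left)

lemma exterior_induct_hom [case_names add hom]:
  fixes w :: "'v::real_vector exterior"
  assumes add: "\<And>v w. P v \<Longrightarrow> P w \<Longrightarrow> P (v + w)" and hom: "\<And>p w. w \<in> ext_power p \<Longrightarrow> P w"
  shows "P w"
proof -
  let ?S = "span (\<Union>p. ext_power p :: 'v exterior set)"
  have hS: "v \<in> ext_power p \<Longrightarrow> v \<in> ?S" for v p by (auto intro: span_base)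
  have "w \<in> ?S"
  proof (induction w rule: exterior_induct)
    case one
    then show ?case using hS one_mem_power by blast
  next
    case (mult x w)
    then show ?case
    proof (induction rule: span_induct)
      case base
      then show ?case
        by (auto simp: subspace_def span_zero span_add span_scale algebra_simps)
    next
      case (step v)
      then show ?case using hS ext_inc_mult_power by blast
    qed
  qed (simp_all add: span_add span_scale)
  then show ?thesis
  proof (induction rule: span_induct_alt)
    case base
    then show ?case using hom[of 0 0] subspace_0[OF subspace_ext_power] by blast
  next
    case (step c v w)
    then show ?case using add hom subspace_scale[OF subspace_ext_power] by (metis UN_E)
  qed
qed

lemma is_poisson_bracket_unique:
  assumes P: "is_poisson_bracket B P" and Q: "is_poisson_bracket B Q"
  shows "P = Q"
proof -
  have lin: "linear (P v)" "linear (Q v)" "linear (\<lambda>v. P v w)" "linear (\<lambda>v. Q v w)" for v w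
    using P Q by (auto simp: is_poisson_bracket_def bilinear_def)
  note lins = linear_add[OF lin(1)] linear_add[OF lin(2)] linear_cmul[OF lin(1)] linear_cmul[OF lin(2)]
    linear_add[OF lin(3)] linear_add[OF lin(4)] linear_cmul[OF lin(3)] linear_cmul[OF lin(4)]
  have sc: "P w 1 = 0" "Q w 1 = 0" for w
    using P Q of_real_1 unfolding is_poisson_bracket_def by metis+
  have leib: "P v (ext_inc x * w) = P v (ext_inc x) * w + (-1) ^ p * ext_inc x * P v w"
     "Q v (ext_inc x * w) = Q v (ext_inc x) * w + (-1) ^ p * ext_inc x * Q v w" if "v \<in> ext_power p" for v p x w
    using P Q that ext_inc_mem_power[of x] unfolding is_poisson_bracket_def by (metis mult.right_neutral)+
  have skew: "P v (ext_inc x) = - ((-1) ^ p * P (ext_inc x) v)" "Q v (ext_inc x) = - ((-1) ^ p * Q (ext_inc x) v)"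
    if "v \<in> ext_power p" for v p x
    using P Q that ext_inc_mem_power[of x] unfolding is_poisson_bracket_def by (metis mult.right_neutral)+
  have VV: "P (ext_inc x) (ext_inc y) = Q (ext_inc x) (ext_inc y)" for x y
    using P Q by (simp add: is_poisson_bracket_def)
  have 1: "P (ext_inc x) w = Q (ext_inc x) w" for x w
    by (induction w rule: exterior_induct)
       (simp_all add: sc leib[OF ext_inc_mem_power] VV lins)
  have 2: "P v w = Q v w" if "v \<in> ext_power p" for v p w
    by (induction w rule: exterior_induct)
       (simp_all add: sc leib[OF that] skew[OF that] 1 lins)
  have "P v w = Q v w" for v w
    by (induction v rule: exterior_induct_hom) (auto simp: lins 2)
  then show ?thesis by blast
qed

lemma ext_inc_anticommute: "ext_inc x * ext_inc y = - (ext_inc y * ext_inc x)"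
  using ext_inc_square[of "x + y"]
  by (simp add: ext_inc_add distrib_left distrib_right ext_inc_square eq_neg_iff_add_eq_0 add.commute)

lemma ext_inc_commute_power:
  "w \<in> ext_power q \<Longrightarrow> ext_inc x * w = (-1) ^ q * (w * ext_inc x)"
proof (induction rule: ext_power_induct)
  case (gen xs)
  have "ext_inc x * prod_list (map ext_inc xs) = (-1) ^ length xs * (prod_list (map ext_inc xs) * ext_inc x)"
  proof (induction xs)
    case (Cons y ys)
    have "ext_inc x * (ext_inc y * prod_list (map ext_inc ys)) = - (ext_inc y * (ext_inc x * prod_list (map ext_inc ys)))"
      using arg_cong[OF ext_inc_anticommute[of x y], of "\<lambda>u. u * prod_list (map ext_inc ys)"]
      by (simp add: mult.assoc)
    then show ?case unfolding list.map prod_list.Cons Cons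
      by (cases "even (length ys)") (simp_all add: mult.assoc)
  qed simp
  then show ?case using gen by simp
qed (simp_all add: distrib_left distrib_right)

lemma commute_power:
  assumes w: "w \<in> ext_power q" and v: "v \<in> ext_power p"
  shows "v * w = (-1) ^ (p * q) * (w * v)"
  using v
proof (induction rule: ext_power_induct)
  case (gen xs)
  have "prod_list (map ext_inc xs) * w = (-1) ^ (length xs * q) * (w * prod_list (map ext_inc xs))"
  proof (induction xs)
    case (Cons y ys)
    have "ext_inc y * (prod_list (map ext_inc ys) * w)
        = (-1) ^ (length ys * q) * ((ext_inc y * w) * prod_list (map ext_inc ys))"
      unfolding Cons by (cases "even (length ys * q)") (simp_all add: mult.assoc)
    also have "\<dots> = (-1) ^ (length (y # ys) * q) * (w * (ext_inc y * prod_list (map ext_inc ys)))"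
      unfolding ext_inc_commute_power[OF w]
      by (cases "even (length ys)"; cases "even q") (simp_all add: mult.assoc)
    finally show ?case by (simp add: mult.assoc)
  qed simp
  then show ?case using gen by simp
qed (simp_all add: distrib_left distrib_right)

lemma parity_exists:
  "\<exists>\<alpha> :: 'v::real_vector exterior \<Rightarrow> 'v exterior.
    linear \<alpha> \<and> \<alpha> 1 = 1 \<and> (\<forall>x w. \<alpha> (ext_inc x * w) = - (ext_inc x * \<alpha> w))"
proof -
  interpret ext_action "\<lambda>(x::'v) w. - (ext_inc x * w)"
    by standard (simp_all add: linear_iff ext_inc_add ext_inc_scale distrib_left distrib_right
        ext_inc_square flip: mult.assoc)
  from ext_act_exists obtain F :: "'v exterior \<Rightarrow> 'v exterior \<Rightarrow> 'v exterior" where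
    "bilinear F" "\<And>b. F 1 b = b" "\<And>x w b. F (ext_inc x * w) b = - (ext_inc x * F w b)" by blast
  then show ?thesis by (intro exI[of _ "\<lambda>w. F w 1"]) (simp add: bilinear_def)
qed

lemma contraction_exists:
  fixes \<beta> :: "'v::real_vector \<Rightarrow> real"
  assumes "linear \<beta>"
  shows "\<exists>D. linear D \<and> D 1 = 0 \<and> (\<forall>x w. D (ext_inc x * w) = \<beta> x *\<^sub>R w - ext_inc x * D w)"
proof -
  let ?f = "\<lambda>x (a, c). (ext_inc x * a, \<beta> x *\<^sub>R a - ext_inc x * c)"
  have "linear (\<lambda>x. ?f x b)" for b
    by (cases b) (simp add: linear_iff ext_inc_add ext_inc_scale distrib_right linear_add[OF assms]
        linear_cmul[OF assms] scaleR_add_left scaleR_diff_right)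
  moreover have "linear (?f x)" for x
    by (auto simp: linear_iff distrib_left scaleR_add_right scaleR_diff_right)
  moreover have "?f x (?f x b) = 0" for x b
    by (cases b) (simp add: right_diff_distrib ext_inc_square zero_prod_def flip: mult.assoc)
  ultimately interpret ext_action ?f by (rule ext_action.intro)
  from ext_act_exists obtain F where F:
    "bilinear F" "\<And>b. F 1 b = b" "\<And>x w b. F (ext_inc x * w) b = ?f x (F w b)" by blast
  have lin: "linear (\<lambda>w. F w b)" for b using F(1) unfolding bilinear_def by blast
  define D where "D w = snd (F w (1, 0))" for w
  have fst: "fst (F w (1, 0)) = w" for w
    by (induction w rule: exterior_induct)
       (simp_all add: F(2,3) linear_add[OF lin] linear_cmul[OF lin] split_beta)
  have "linear D"
    unfolding D_def linear_iff by (simp add: linear_add[OF lin] linear_cmul[OF lin])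
  moreover have "D 1 = 0" by (simp add: D_def F(2))
  moreover have "D (ext_inc x * w) = \<beta> x *\<^sub>R w - ext_inc x * D w" for x w
    unfolding D_def F(3) by (simp add: split_beta fst)
  ultimately show ?thesis by blast
qed

lemma orthonormal_basis_expand:
  assumes B: "bilinear B" and e: "orthonormal_basis B m e"
  shows "B x y = (\<Sum>i=1..m. B (e i) x * B (e i) y)"
proof -
  have lin: "linear (\<lambda>x. B x y)" "linear (B x)" for x y
    using B by (auto simp: bilinear_def)
  have "x \<in> span (e ` {1..m})" using e by (simp add: orthonormal_basis_def)
  then show ?thesis
  proof (induction rule: span_induct_alt)
    case base
    then show ?case by (simp add: linear_0[OF lin(1)] linear_0[OF lin(2)])
  next
    case (step c v w)
    then obtain j where j: "v = e j" "j \<in> {1..m}" by blast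
    have "(\<Sum>i=1..m. B (e i) v * B (e i) y) = (\<Sum>i=1..m. if i = j then B (e i) y else 0)"
      using e j by (intro sum.cong) (auto simp: orthonormal_basis_def)
    also have "\<dots> = B v y" using j by simp
    finally show ?case
      using step by (simp add: linear_add[OF lin(1)] linear_add[OF lin(2)] linear_cmul[OF lin(1)]
        linear_cmul[OF lin(2)] distrib_right sum.distrib mult.assoc flip: sum_distrib_left)
  qed
qed

lemma is_poisson_bracket_exists:
  fixes B :: "'v::real_vector \<Rightarrow> 'v \<Rightarrow> real"
  assumes B: "bilinear B" and e: "orthonormal_basis B m e"
  shows "\<exists>P. is_poisson_bracket B P"
proof -
  obtain \<alpha> :: "'v exterior \<Rightarrow> 'v exterior" where
    \<alpha>: "linear \<alpha>" "\<alpha> 1 = 1" "\<And>x w. \<alpha> (ext_inc x * w) = - (ext_inc x * \<alpha> w)"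
    using parity_exists by blast
  have lB: "linear (B x)" for x using B by (simp add: bilinear_def)
  have "\<forall>i. \<exists>D. linear D \<and> D 1 = 0 \<and> (\<forall>x w. D (ext_inc x * w) = B (e i) x *\<^sub>R w - ext_inc x * D w)"
    using contraction_exists[OF lB] by blast
  then obtain D where D: "\<And>i. linear (D i)" "\<And>i. D i 1 = 0"
    "\<And>i x w. D i (ext_inc x * w) = B (e i) x *\<^sub>R w - ext_inc x * D i w" by metis
  note lin = linear_add[OF \<alpha>(1)] linear_cmul[OF \<alpha>(1)] linear_add[OF D(1)] linear_cmul[OF D(1)]
    linear_0[OF \<alpha>(1)] linear_0[OF D(1)]
  have D_mult: "D i (v * w) = D i v * w + \<alpha> v * D i w" for i v w
    by (induction v rule: exterior_induct)
       (simp_all add: lin \<alpha>(2,3) D(2,3) algebra_simps)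
  have \<alpha>_power: "\<alpha> v = (-1) ^ p * v" if "v \<in> ext_power p" for v p
    using that
  proof (induction rule: ext_power_induct)
    case (gen xs)
    have "\<alpha> (prod_list (map ext_inc xs)) = (-1) ^ length xs * prod_list (map ext_inc xs)"
    proof (induction xs)
      case (Cons y ys)
      then show ?case by (cases "even (length ys)") (simp_all add: \<alpha>(3))
    qed (simp add: \<alpha>(2))
    then show ?case using gen by simp
  qed (simp_all add: lin distrib_left)
  have D0: "D i v = 0" if "v \<in> ext_power 0" for i v
    using that by (induction rule: ext_power_induct) (simp_all add: lin D(2))
  have DS: "D i v \<in> ext_power p" if "v \<in> ext_power (Suc p)" for i v p
    using that
  proof (induction rule: ext_power_induct)
    case (gen xs)
    then show ?case
    proof (induction xs arbitrary: p)
      case (Cons y ys)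
      have 1: "B (e i) y *\<^sub>R prod_list (map ext_inc ys) \<in> ext_power p"
        using Cons.prems prod_mem_power[of ys p] by (simp add: subspace_scale subspace_ext_power)
      have 2: "ext_inc y * D i (prod_list (map ext_inc ys)) \<in> ext_power p"
      proof (cases p)
        case 0
        then show ?thesis
          using Cons.prems by (simp add: D(2) subspace_0 subspace_ext_power)
      next
        case (Suc q)
        then show ?thesis using Cons.IH[of q] Cons.prems by (simp add: ext_inc_mult_power)
      qed
      show ?case using 1 2 by (simp add: D(3) subspace_diff subspace_ext_power)
    qed simp
  qed (simp_all add: lin subspace_0 subspace_add subspace_scale subspace_ext_power)
  define P where "P v w = (\<Sum>i=1..m. \<alpha> (D i v) * D i w)" for v w
  have "bilinear P"
    by (simp add: bilinear_def linear_iff P_def lin algebra_simps sum.distrib flip: scaleR_sum_right)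
  moreover have "P (of_real c) w = 0" "P w (of_real c) = 0" for c w
    by (simp_all add: P_def of_real_def lin D(2))
  moreover have "P (ext_inc x) (ext_inc y) = of_real (B x y)" for x y
  proof -
    have Dx: "D i (ext_inc x) = B (e i) x *\<^sub>R 1" for i x using D(3)[of i x 1] by (simp add: D(2))
    show ?thesis unfolding orthonormal_basis_expand[OF B e, of x y]
      by (simp add: P_def Dx lin \<alpha>(2) of_real_def scaleR_sum_left mult.commute)
  qed
  moreover have "P v (w1 * w2) = P v w1 * w2 + (-1) ^ (p * q) * w1 * P v w2"
    if v: "v \<in> ext_power p" and w1: "w1 \<in> ext_power q" for v w1 w2 p q
  proof -
    have "\<alpha> (D i v) * (\<alpha> w1 * D i w2) = (-1) ^ (p * q) * w1 * (\<alpha> (D i v) * D i w2)" for i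
    proof (cases p)
      case 0
      then show ?thesis using v by (simp add: D0 lin)
    next
      case (Suc r)
      then have r: "D i v \<in> ext_power r" using v DS by blast
      have "D i v * (w1 * D i w2) = (-1) ^ (r * q) * (w1 * (D i v * D i w2))"
        using arg_cong[OF commute_power[OF w1 r], of "\<lambda>u. u * D i w2"] by (simp add: mult.assoc)
      then show ?thesis
        unfolding \<alpha>_power[OF r] \<alpha>_power[OF w1] Suc
        by (cases "even r"; cases "even q") (simp_all add: mult.assoc)
    qed
    then show ?thesis
      by (simp add: P_def D_mult distrib_left sum.distrib sum_distrib_left sum_distrib_right mult.assoc)
  qed
  moreover have "P v w = - ((-1) ^ (p * q) * P w v)"
    if v: "v \<in> ext_power p" and w: "w \<in> ext_power q" for v w p q
  proof -
    have "\<alpha> (D i v) * D i w = - ((-1) ^ (p * q) * (\<alpha> (D i w) * D i v))" for i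
    proof (cases "p = 0 \<or> q = 0")
      case True
      then show ?thesis using v w by (auto simp: D0 lin)
    next
      case False
      then obtain r s where rs: "p = Suc r" "q = Suc s" by (metis not0_implies_Suc)
      have r: "D i v \<in> ext_power r" and s: "D i w \<in> ext_power s" using v w rs DS by blast+
      show ?thesis
        unfolding \<alpha>_power[OF r] \<alpha>_power[OF s] rs mult.assoc commute_power[OF s r]
        by (cases "even r"; cases "even s") simp_all
    qed
    then show ?thesis by (simp add: P_def sum_distrib_left sum_negf)
  qed
  ultimately have "is_poisson_bracket B P" unfolding is_poisson_bracket_def by blast
  then show ?thesis by blast
qed

lemma poisson_bracket:
  assumes "bilinear B" "orthonormal_basis B m e"
  shows "is_poisson_bracket B (poisson_bracket B)"
proof -
  have "\<exists>!P. is_poisson_bracket B P"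
    using is_poisson_bracket_exists[OF assms] is_poisson_bracket_unique by blast
  then show ?thesis unfolding poisson_bracket_def by (rule theI')
qed

definition ext_volume :: "nat \<Rightarrow> (nat \<Rightarrow> 'v::real_vector) \<Rightarrow> 'v exterior"
  where "ext_volume m e = prod_list (map (\<lambda>i. ext_inc (e i)) [1..<Suc m])"

definition is_hodge_star ::
  "('v::real_vector \<Rightarrow> 'v \<Rightarrow> real) \<Rightarrow> nat \<Rightarrow> (nat \<Rightarrow> 'v) \<Rightarrow> ('v exterior \<Rightarrow> 'v exterior) \<Rightarrow> bool"
  where "is_hodge_star B m e S \<longleftrightarrow> linear S \<and>
    (\<forall>xs. S (prod_list (map ext_inc xs)) = foldr (\<lambda>x. poisson_bracket B (ext_inc x)) xs (ext_volume m e))"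

definition hodge_star ::
  "('v::real_vector \<Rightarrow> 'v \<Rightarrow> real) \<Rightarrow> nat \<Rightarrow> (nat \<Rightarrow> 'v) \<Rightarrow> 'v exterior \<Rightarrow> 'v exterior"
  where "hodge_star B m e = (THE S. is_hodge_star B m e S)"

lemma is_hodge_star_unique:
  assumes "is_hodge_star B m e S" "is_hodge_star B m e T"
  shows "S = T"
proof -
  have lin: "linear S" "linear T" using assms by (simp_all add: is_hodge_star_def)
  note lins = linear_add[OF lin(1)] linear_add[OF lin(2)] linear_cmul[OF lin(1)] linear_cmul[OF lin(2)]
    linear_0[OF lin(1)] linear_0[OF lin(2)]
  have power: "S w = T w" if "w \<in> ext_power p" for w p
    using that assms by (induction rule: ext_power_induct) (simp_all add: lins is_hodge_star_def)
  have "S w = T w" for w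
    by (induction w rule: exterior_induct_hom) (auto simp: lins power)
  then show ?thesis by blast
qed

lemma is_hodge_star_exists:
  fixes B :: "'v::real_vector \<Rightarrow> 'v \<Rightarrow> real"
  assumes "bilinear B" "orthonormal_basis B m e"
  shows "\<exists>S. is_hodge_star B m e S"
proof -
  let ?f = "\<lambda>x. poisson_bracket B (ext_inc x)"
  have P: "is_poisson_bracket B (poisson_bracket B)" by (rule poisson_bracket[OF assms])
  have lin: "linear (poisson_bracket B v)" "linear (\<lambda>v. poisson_bracket B v w)" for v w
    using P by (auto simp: is_poisson_bracket_def bilinear_def)
  note lins = linear_add[OF lin(1)] linear_cmul[OF lin(1)] linear_add[OF lin(2)] linear_cmul[OF lin(2)]
    linear_0[OF lin(1)] linear_diff[OF lin(1)]
  have one: "?f x 1 = 0" for x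
    using P of_real_1 unfolding is_poisson_bracket_def by metis
  have leib: "?f x (ext_inc y * w) = B x y *\<^sub>R w - ext_inc y * ?f x w" for x y w
  proof -
    have "?f x (ext_inc y * w) = ?f x (ext_inc y) * w + (-1) ^ (1 * 1) * ext_inc y * ?f x w"
      using P ext_inc_mem_power[of x] ext_inc_mem_power[of y] unfolding is_poisson_bracket_def by blast
    moreover have "?f x (ext_inc y) = of_real (B x y)"
      using P unfolding is_poisson_bracket_def by blast
    ultimately show ?thesis by (simp add: of_real_def)
  qed
  have "linear (\<lambda>x. ?f x w)" for w
    by (simp add: linear_iff ext_inc_add ext_inc_scale lins)
  moreover have "?f x (?f x w) = 0" for x w
    by (induction w rule: exterior_induct) (simp_all add: one leib lins)
  ultimately interpret ext_action ?f by (intro ext_action.intro lin(1))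
  from ext_act_exists obtain F where F:
    "bilinear F" "\<And>b. F 1 b = b" "\<And>x w b. F (ext_inc x * w) b = ?f x (F w b)" by blast
  have "F (prod_list (map ext_inc xs)) (ext_volume m e) = foldr ?f xs (ext_volume m e)" for xs
    by (induction xs) (simp_all add: F(2,3))
  then have "is_hodge_star B m e (\<lambda>w. F w (ext_volume m e))"
    using F(1) by (simp add: is_hodge_star_def bilinear_def)
  then show ?thesis by blast
qed

lemma hodge_star:
  assumes "bilinear B" "orthonormal_basis B m e"
  shows "is_hodge_star B m e (hodge_star B m e)"
proof -
  have "\<exists>!S. is_hodge_star B m e S"
    using is_hodge_star_exists[OF assms] is_hodge_star_unique by blast
  then show ?thesis unfolding hodge_star_def by (rule theI')
qed


section \<open>Metric \<open>L\<^sub>\<infinity>\<close>-algebras and their Hodge operators\<close>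

definition metric_Linf :: "('v::real_vector \<Rightarrow> 'v \<Rightarrow> real) \<Rightarrow> 'v exterior \<Rightarrow> bool"
  where "metric_Linf B \<mu> \<longleftrightarrow> \<mu> \<in> ext_odd \<and> poisson_bracket B \<mu> \<mu> \<in> ext_power 0"

definition Linf_d :: "('v::real_vector \<Rightarrow> 'v \<Rightarrow> real) \<Rightarrow> 'v exterior \<Rightarrow> 'v exterior \<Rightarrow> 'v exterior"
  where "Linf_d B \<mu> = poisson_bracket B \<mu>"

text \<open>The family \<open>\<mu>k\<close> lists the homogeneous components of \<open>\<mu>\<close>, with \<open>\<mu>k k\<close> of degree
  \<open>k + 2\<close>; as degrees run from \<open>0\<close> to \<open>m\<close>, the index starts at \<open>-2\<close>.\<close>

definition Linf_codiff ::
  "('v::real_vector \<Rightarrow> 'v \<Rightarrow> real) \<Rightarrow> nat \<Rightarrow> (nat \<Rightarrow> 'v) \<Rightarrow> (int \<Rightarrow> 'v exterior) \<Rightarrow>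
    'v exterior \<Rightarrow> 'v exterior"
  where "Linf_codiff B m e \<mu>k w =
    (\<Sum>k = -2..int m - 2. ((-1) powi (k * (1 - k) div 2)) *\<^sub>R
       hodge_star B m e (Linf_d B (\<mu>k k) (hodge_star B m e w)))"

definition Linf_laplacian ::
  "('v::real_vector \<Rightarrow> 'v \<Rightarrow> real) \<Rightarrow> nat \<Rightarrow> (nat \<Rightarrow> 'v) \<Rightarrow> 'v exterior \<Rightarrow> (int \<Rightarrow> 'v exterior) \<Rightarrow>
    'v exterior \<Rightarrow> 'v exterior"
  where "Linf_laplacian B m e \<mu> \<mu>k w =
    Linf_codiff B m e \<mu>k (Linf_d B \<mu> w) + Linf_d B \<mu> (Linf_codiff B m e \<mu>k w)"

definition direct_sum3 :: "'a::real_vector set \<Rightarrow> 'a set \<Rightarrow> 'a set \<Rightarrow> bool"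
  where "direct_sum3 X Y Z \<longleftrightarrow> subspace X \<and> subspace Y \<and> subspace Z \<and>
    (\<forall>w. \<exists>!(x, y, z) \<in> X \<times> Y \<times> Z. w = x + y + z)"

definition coset :: "'a::real_vector set \<Rightarrow> 'a \<Rightarrow> 'a set"
  where "coset U w = {w + u | u. u \<in> U}"

text \<open>Linear isomorphism of \<open>K\<close> with the quotient space \<open>Z / U\<close>, whose elements are the
  cosets of \<open>U\<close> in \<open>Z\<close>, added and scaled through representatives.\<close>

definition iso_quotient :: "'a::real_vector set \<Rightarrow> 'a set \<Rightarrow> 'a set \<Rightarrow> bool"
  where "iso_quotient K Z U \<longleftrightarrow>
    subspace K \<and> subspace Z \<and> subspace U \<and> U \<subseteq> Z \<and>
    (\<exists>\<phi>. bij_betw \<phi> K (coset U ` Z) \<and>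
      (\<forall>x\<in>K. \<forall>y\<in>K. \<phi> (x + y) = {a + b | a b. a \<in> \<phi> x \<and> b \<in> \<phi> y}) \<and>
      (\<forall>c. \<forall>x\<in>K. \<phi> (c *\<^sub>R x) = {c *\<^sub>R a + u | a u. a \<in> \<phi> x \<and> u \<in> U}))"

end

theory Submission
  imports Defs
begin

text \<open>For \<open>x \<in> V\<close> the bracket \<open>[x, -]\<close> is the contraction with \<open>x\<close>, and the exterior algebra carries
  an inner product for which contraction is adjoint to multiplication by \<open>x\<close>; it is positive
  definite because \<open>\<Sum>i. e\<^sub>i \<and> [e\<^sub>i, -]\<close> is multiplication by the degree. The star operator
  interchanges contraction and multiplication, so its square commutes with both and is a nonzero
  scalar \<open>c\<close>. Since \<open>d\<^sub>k = \<Sum>i. [e\<^sub>i, \<mu>\<^sub>k] \<and> [e\<^sub>i, -]\<close>, the operator \<open>* d\<^sub>k *\<close> is the adjoint of \<open>d\<^sub>k\<close> up to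
  the factor \<open>c\<close> and the sign \<open>(-1)\<^bsup>k(k+1)/2\<^esup>\<close> with which reversal acts in degree \<open>k + 1\<close>. For odd
  \<open>k\<close> this sign combines with \<open>(-1)\<^bsup>k(1-k)/2\<^esup>\<close> to \<open>-1\<close>, so \<open>\<delta>\<close> is the adjoint of \<open>d\<close> times \<open>-c\<close>, and
  the claim is the finite-dimensional Hodge decomposition.\<close>

section \<open>Finite-dimensional Hodge decomposition\<close>

locale inner_form =
  fixes ip :: "'a::real_vector \<Rightarrow> 'a \<Rightarrow> real"
  assumes bilinear_ip: "bilinear ip"
    and ip_commute: "ip v w = ip w v"
    and ip_pos: "v \<noteq> 0 \<Longrightarrow> 0 < ip v v"
begin

lemma linear_ip: "linear (ip v)" "linear (\<lambda>v. ip v w)"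
  using bilinear_ip by (auto simp: bilinear_def)

lemmas ip_simps = linear_add[OF linear_ip(1)] linear_add[OF linear_ip(2)]
  linear_diff[OF linear_ip(1)] linear_diff[OF linear_ip(2)]
  linear_cmul[OF linear_ip(1)] linear_cmul[OF linear_ip(2)]
  linear_0[OF linear_ip(1)] linear_0[OF linear_ip(2)]
  linear_sum[OF linear_ip(1)] linear_sum[OF linear_ip(2)]

lemma ip_eq_0: "ip v v = 0 \<Longrightarrow> v = 0"
  using ip_pos[of v] by force

lemma ip_nonneg: "0 \<le> ip v v"
  using ip_pos[of v] by (cases "v = 0") (simp_all add: ip_simps)

lemma ip_span_right:
  assumes "\<forall>s\<in>S. ip v s = 0" "u \<in> span S"
  shows "ip v u = 0"
  using assms(2) by (induction rule: span_induct_alt) (use assms(1) in \<open>simp_all add: ip_simps\<close>)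

text \<open>Gram-Schmidt, one spanning vector at a time: the part \<open>a - b\<close> of the new
  vector that is orthogonal to \<open>span S\<close> corrects the projection \<open>u\<close> onto
  \<open>span S\<close>.\<close>

lemma orthogonal_projection_exists:
  assumes "finite S"
  shows "\<exists>u\<in>span S. \<forall>s\<in>span S. ip (w - u) s = 0"
proof -
  have "\<exists>u\<in>span S. \<forall>s\<in>S. ip (w - u) s = 0" using assms
  proof (induction S arbitrary: w rule: finite_induct)
    case (insert a S)
    obtain b where b: "b \<in> span S" "\<forall>s\<in>S. ip (a - b) s = 0" using insert.IH by blast
    obtain u where u: "u \<in> span S" "\<forall>s\<in>S. ip (w - u) s = 0" using insert.IH by blast
    have wb: "ip (w - u) b = 0" using ip_span_right u(2) b(1) by blast
    have ab: "ip (a - b) b = 0" using ip_span_right b by blast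
    \<comment> \<open>This coefficient makes the residue orthogonal to \<open>a - b\<close>, hence
      to \<open>a\<close>. If \<open>a = b\<close>, the division by zero is harmless because the
      correction vanishes.\<close>
    define t where "t = ip (w - u) a / ip (a - b) (a - b)"
    have "ip (w - (u + t *\<^sub>R (a - b))) a = 0"
    proof (cases "a = b")
      case True
      then show ?thesis using wb by simp
    next
      case False
      then have "ip (a - b) (a - b) \<noteq> 0" using ip_eq_0 by fastforce
      moreover have "ip (a - b) (a - b) = ip (a - b) a" using ab by (simp add: ip_simps)
      ultimately show ?thesis by (simp add: t_def ip_simps)
    qed
    moreover have "\<forall>s\<in>S. ip (w - (u + t *\<^sub>R (a - b))) s = 0"
      using u(2) b(2) by (simp add: ip_simps)
    moreover have "u + t *\<^sub>R (a - b) \<in> span (insert a S)"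
      using u(1) b(1) by (meson insertI1 span_add span_base span_diff span_mono span_scale subsetD subset_insertI)
    ultimately show ?case by blast
  qed (auto simp: span_zero)
  then show ?thesis using ip_span_right by blast
qed

lemma orthogonal_decomposition:
  fixes f :: "'b::real_vector \<Rightarrow> 'a" and S :: "'b set"
  assumes "finite S" "span S = UNIV" "linear f"
  shows "\<exists>a h. w = f a + h \<and> (\<forall>b. ip h (f b) = 0)"
proof -
  have "span (f ` S) = range f" using linear_span_image[OF assms(3), of S] assms(2) by simp
  then obtain u where u: "u \<in> range f" "\<forall>s\<in>range f. ip (w - u) s = 0"
    using orthogonal_projection_exists[of "f ` S" w] assms(1) by auto
  then obtain a where "u = f a" by blast
  then have "w = f a + (w - u) \<and> (\<forall>b. ip (w - u) (f b) = 0)" using u by simp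
  then show ?thesis by blast
qed

end

text \<open>The factor \<open>r\<close> lets \<delta> be the adjoint of \<open>d\<close> up to a
  scalar of either sign. Star conjugation yields \<open>r = - c\<close>, where \<open>c\<close> is
  the scalar by which the star squares.\<close>

locale hodge_complex = inner_form +
  fixes d \<delta> :: "'a::real_vector \<Rightarrow> 'a" and r :: real
  assumes lin_d: "linear d" and d_d: "d (d w) = 0"
    and lin_\<delta>: "linear \<delta>" and adjoint: "ip v (\<delta> w) = r * ip (d v) w" and r: "r \<noteq> 0"
    and fin: "\<exists>S. finite S \<and> span S = (UNIV :: 'a set)"
begin

lemmas lins = linear_add[OF lin_d] linear_add[OF lin_\<delta>] linear_diff[OF lin_d] linear_diff[OF lin_\<delta>]
  linear_cmul[OF lin_d] linear_cmul[OF lin_\<delta>] linear_0[OF lin_d] linear_0[OF lin_\<delta>]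

text \<open>Moving both operators across the form turns them into \<open>d\<close> applied twice, so
  the norm of this element is zero.\<close>

lemma \<delta>_\<delta>: "\<delta> (\<delta> w) = 0"
proof (rule ip_eq_0)
  show "ip (\<delta> (\<delta> w)) (\<delta> (\<delta> w)) = 0"
    unfolding adjoint[of "\<delta> (\<delta> w)" "\<delta> w"] adjoint[of "d (\<delta> (\<delta> w))" w] by (simp add: d_d ip_simps)
qed

lemma harmonic_iff: "\<delta> (d w) + d (\<delta> w) = 0 \<longleftrightarrow> d w = 0 \<and> \<delta> w = 0"
proof
  assume "\<delta> (d w) + d (\<delta> w) = 0"
  \<comment> \<open>Multiplying by \<open>r\<close> makes both resulting terms nonnegative whatever
    the sign of \<open>r\<close>.\<close>
  then have "0 = r * ip w (\<delta> (d w) + d (\<delta> w))" by (simp add: ip_simps)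
  also have "\<dots> = r\<^sup>2 * ip (d w) (d w) + ip (\<delta> w) (\<delta> w)"
    using adjoint[of w "d w"] adjoint[of "\<delta> w" w]
    by (simp add: ip_simps algebra_simps power2_eq_square ip_commute[of w])
  finally have "r\<^sup>2 * ip (d w) (d w) = 0" "ip (\<delta> w) (\<delta> w) = 0"
    using ip_nonneg[of "d w"] ip_nonneg[of "\<delta> w"]
    by (smt (verit) mult_nonneg_nonneg zero_le_power2)+
  then show "d w = 0 \<and> \<delta> w = 0" using r ip_eq_0 by simp
qed (simp add: lins)

lemma decomposition_exists: "\<exists>a b h. w = d a + \<delta> b + h \<and> d h = 0 \<and> \<delta> h = 0"
proof -
  obtain S :: "'a set" where S: "finite S" "span S = UNIV" using fin by blast
  obtain a w' where a: "w = d a + w'" "\<And>b. ip w' (d b) = 0"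
    using orthogonal_decomposition[OF S lin_d] by metis
  obtain b h where b: "w' = \<delta> b + h" "\<And>c. ip h (\<delta> c) = 0"
    using orthogonal_decomposition[OF S lin_\<delta>] by metis
  \<comment> \<open>Orthogonality of \<open>w'\<close> to \<open>range d\<close> gives
    \<open>\<delta> w' = 0\<close>; removing \<open>\<delta> b\<close> preserves this since \<delta>
    squares to zero.\<close>
  have "ip (\<delta> w') (\<delta> w') = 0" using adjoint[of "\<delta> w'" w'] a(2) by (simp add: ip_commute)
  then have "\<delta> h = 0" using ip_eq_0 b(1) by (fastforce simp: lins \<delta>_\<delta>)
  moreover have "d h = 0" using b(2)[of "d h"] adjoint[of h "d h"] r ip_eq_0 by simp
  ultimately show ?thesis using a b by (metis add.assoc)
qed

text \<open>The three summands are pairwise orthogonal, so pairing the zero sum with one of them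
  leaves only its norm.\<close>

lemma decomposition_zero:
  assumes "d a + \<delta> b + h = 0" "d h = 0" "\<delta> h = 0"
  shows "d a = 0 \<and> \<delta> b = 0 \<and> h = 0"
proof -
  have 1: "ip (d u) (\<delta> v) = 0" for u v using adjoint[of "d u" v] by (simp add: d_d ip_simps)
  have 2: "ip h (\<delta> v) = 0" for v using adjoint[of h v] assms by (simp add: ip_simps)
  have 3: "ip (d u) h = 0" for u using adjoint[of u h] assms r by (simp add: ip_simps)
  have "ip (d a) (d a + \<delta> b + h) = 0" "ip h (d a + \<delta> b + h) = 0"
    using assms(1) by (simp_all add: ip_simps)
  then have "d a = 0" "h = 0"
    using 1 2 3 by (auto simp: linear_add[OF linear_ip(1)] ip_commute[of h "d a"] intro: ip_eq_0)
  then show ?thesis using assms(1) by simp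
qed

lemma subspace_range: "subspace (range d)" "subspace (range \<delta>)"
  using lin_d lin_\<delta> by (simp_all add: linear_subspace_image)

lemma subspace_kernel: "subspace {w. d w = 0}" "subspace {w. d w = 0 \<and> \<delta> w = 0}"
  by (auto simp: subspace_def lins)

theorem direct_sum_decomposition:
  "direct_sum3 (range d) (range \<delta>) {w. \<delta> (d w) + d (\<delta> w) = 0}"
proof -
  have "\<exists>!(x, y, z) \<in> range d \<times> range \<delta> \<times> {w. d w = 0 \<and> \<delta> w = 0}. w = x + y + z" for w
  proof -
    obtain a b h where w: "w = d a + \<delta> b + h" "d h = 0" "\<delta> h = 0"
      using decomposition_exists by blast
    show ?thesis
    proof (rule ex1I[of _ "(d a, \<delta> b, h)"])
      fix t assume "case t of (x, y, z) \<Rightarrow>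
        (x, y, z) \<in> range d \<times> range \<delta> \<times> {w. d w = 0 \<and> \<delta> w = 0} \<and> w = x + y + z"
      then obtain a' b' h' where t: "t = (d a', \<delta> b', h')" "d h' = 0" "\<delta> h' = 0" "w = d a' + \<delta> b' + h'"
        by auto
      then have "d (a' - a) + \<delta> (b' - b) + (h' - h) = 0" using w by (simp add: lins algebra_simps)
      then have "d (a' - a) = 0 \<and> \<delta> (b' - b) = 0 \<and> h' - h = 0"
        using w t by (intro decomposition_zero) (simp_all add: lins)
      then show "t = (d a, \<delta> b, h)" using t by (simp add: lins)
    qed (use w in auto)
  qed
  then show ?thesis
    unfolding direct_sum3_def harmonic_iff by (intro conjI allI subspace_range subspace_kernel)
qed

text \<open>The isomorphism takes a harmonic element to its cohomology class.\<close>

theorem harmonic_iso_cohomology: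
  "iso_quotient {w. \<delta> (d w) + d (\<delta> w) = 0} {w. d w = 0} (range d)"
proof -
  let ?c = "coset (range d)"
  let ?K = "{w. d w = 0 \<and> \<delta> w = 0}"
  have coset_eq: "?c x = ?c y \<longleftrightarrow> x - y \<in> range d" for x y
  proof
    assume "?c x = ?c y"
    moreover have "x \<in> ?c x" unfolding coset_def using lins(7) by force
    ultimately obtain a where "x = y + d a" unfolding coset_def by auto
    then show "x - y \<in> range d" by simp
  next
    assume "x - y \<in> range d"
    then obtain a where x: "x = y + d a" by (metis add.commute diff_add_cancel imageE)
    have "x + d b = y + d (a + b)" "y + d b = x + d (b - a)" for b by (simp_all add: x lins)
    then show "?c x = ?c y" unfolding coset_def by blast
  qed
  \<comment> \<open>Harmonic elements in the same class differ by an element both exact and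
    harmonic, which is zero by \<open>decomposition_zero\<close>.\<close>
  have "inj_on ?c ?K"
  proof (rule inj_onI)
    fix x y assume xy: "x \<in> ?K" "y \<in> ?K" "?c x = ?c y"
    then obtain a where "x - y = d a" using coset_eq by auto
    then have "d (- a) + \<delta> 0 + (x - y) = 0" by (simp add: lins linear_neg[OF lin_d])
    then show "x = y" using decomposition_zero[of "- a" 0 "x - y"] xy by (simp add: lins)
  qed
  moreover have "?c ` ?K = ?c ` {w. d w = 0}"
  proof (intro equalityI subsetI)
    fix X assume "X \<in> ?c ` {w. d w = 0}"
    then obtain w where X: "X = ?c w" "d w = 0" by blast
    obtain a b h where w: "w = d a + \<delta> b + h" "d h = 0" "\<delta> h = 0"
      using decomposition_exists by blast
    \<comment> \<open>For closed \<open>w\<close> the coexact part is closed too, so its norm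
      \<open>r * ip (d (\<delta> b)) b\<close> is zero and \<open>w\<close> differs from its
      harmonic part by an exact element.\<close>
    have "d (\<delta> b) = 0" using X(2) w by (simp add: lins d_d)
    then have "ip (\<delta> b) (\<delta> b) = 0" using adjoint[of "\<delta> b" b] by (simp add: ip_simps)
    then have "w - h = d a" using w ip_eq_0 by simp
    then have "X = ?c h" using X coset_eq by blast
    then show "X \<in> ?c ` ?K" using w by blast
  qed blast
  ultimately have bij: "bij_betw ?c ?K (?c ` {w. d w = 0})" by (simp add: bij_betw_def)
  have "?c (x + y) = {a + b |a b. a \<in> ?c x \<and> b \<in> ?c y}" for x y
  proof -
    have "(x + d a) + (y + d b) = (x + y) + d (a + b)" "(x + y) + d a = (x + d a) + (y + d 0)" for a b
      by (simp_all add: lins algebra_simps)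
    then show ?thesis unfolding coset_def by (intro equalityI subsetI; blast)
  qed
  moreover have "?c (c *\<^sub>R x) = {c *\<^sub>R a + u |a u. a \<in> ?c x \<and> u \<in> range d}" for c x
  proof -
    have "c *\<^sub>R (x + d a) + d b = c *\<^sub>R x + d (c *\<^sub>R a + b)" "c *\<^sub>R x + d a = c *\<^sub>R (x + d 0) + d a" for a b
      by (simp_all add: lins algebra_simps)
    then show ?thesis unfolding coset_def by (intro equalityI subsetI; blast)
  qed
  moreover have "range d \<subseteq> {w. d w = 0}" using d_d by auto
  ultimately show ?thesis
    unfolding iso_quotient_def harmonic_iff
    by (intro conjI exI[of _ ?c] bij allI ballI subspace_range subspace_kernel)
qed

end

section \<open>Reversal, scalar part and grading\<close>

text \<open>The anti-automorphism taking \<open>x1 ... xp\<close> to \<open>xp ... x1\<close>. It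
  links multiplication by an element to its adjoint, an iterated contraction.\<close>

definition reversal :: "'v::real_vector exterior \<Rightarrow> 'v exterior" where
  "reversal = (SOME \<rho>. linear \<rho> \<and> \<rho> 1 = 1 \<and> (\<forall>x w. \<rho> (ext_inc x * w) = \<rho> w * ext_inc x))"

definition scalar_part :: "'v::real_vector exterior \<Rightarrow> real" where
  "scalar_part = (SOME \<epsilon>. linear \<epsilon> \<and> \<epsilon> 1 = 1 \<and> (\<forall>x w. \<epsilon> (ext_inc x * w) = 0))"

text \<open>Right multiplication by \<open>ext_inc x\<close> squares to zero, so it extends to an
  action of the exterior algebra; acting on \<open>1\<close> gives the reversal.\<close>

lemma reversal:
  fixes w :: "'a::real_vector exterior"
  shows "linear (reversal :: 'a exterior \<Rightarrow> 'a exterior)" "reversal 1 = (1 :: 'a exterior)"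
    "reversal (ext_inc x * w) = reversal w * ext_inc x"
proof -
  interpret ext_action "\<lambda>(x::'a) w. w * ext_inc x"
    by standard (simp_all add: linear_iff ext_inc_add ext_inc_scale distrib_left distrib_right
        ext_inc_square mult.assoc)
  from ext_act_exists obtain F :: "'a exterior \<Rightarrow> 'a exterior \<Rightarrow> 'a exterior" where
    "bilinear F" "\<And>b. F 1 b = b" "\<And>x w b. F (ext_inc x * w) b = F w b * ext_inc x" by blast
  then have "\<exists>\<rho> :: 'a exterior \<Rightarrow> 'a exterior.
      linear \<rho> \<and> \<rho> 1 = 1 \<and> (\<forall>x w. \<rho> (ext_inc x * w) = \<rho> w * ext_inc x)"
    by (intro exI[of _ "\<lambda>w. F w 1"]) (simp add: bilinear_def)
  from someI_ex[OF this, folded reversal_def] show "linear (reversal :: 'a exterior \<Rightarrow> _)" "reversal 1 = (1 :: 'a exterior)"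
    "reversal (ext_inc x * w) = reversal w * ext_inc x" by blast+
qed

lemma scalar_part:
  fixes w :: "'a::real_vector exterior"
  shows "linear (scalar_part :: 'a exterior \<Rightarrow> real)" "scalar_part (1 :: 'a exterior) = 1"
    "scalar_part (ext_inc x * w) = 0"
proof -
  interpret ext_action "\<lambda>(x::'a) (r::real). 0"
    by standard (simp_all add: linear_iff)
  from ext_act_exists obtain F :: "'a exterior \<Rightarrow> real \<Rightarrow> real" where
    "bilinear F" "\<And>b. F 1 b = b" "\<And>x w b. F (ext_inc x * w) b = 0" by blast
  then have "\<exists>\<epsilon> :: 'a exterior \<Rightarrow> real. linear \<epsilon> \<and> \<epsilon> 1 = 1 \<and> (\<forall>x w. \<epsilon> (ext_inc x * w) = 0)"
    by (intro exI[of _ "\<lambda>w. F w 1"]) (simp add: bilinear_def)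
  from someI_ex[OF this, folded scalar_part_def] show "linear (scalar_part :: 'a exterior \<Rightarrow> _)" "scalar_part (1 :: 'a exterior) = 1"
    "scalar_part (ext_inc x * w) = 0" by blast+
qed

lemmas reversal_simps = reversal(2,3) linear_add[OF reversal(1)] linear_cmul[OF reversal(1)]
  linear_0[OF reversal(1)]

lemmas scalar_part_simps = scalar_part(2,3) linear_add[OF scalar_part(1)]
  linear_diff[OF scalar_part(1)] linear_cmul[OF scalar_part(1)] linear_0[OF scalar_part(1)]

lemma reversal_mult: "reversal (v * w) = reversal w * reversal v"
  by (induction v rule: exterior_induct)
     (simp_all add: reversal_simps algebra_simps mult.assoc)

text \<open>Moving a leading vector past \<open>n\<close> others costs \<open>(-1) ^ n\<close>, and
  \<open>n + (n choose 2)\<close> is \<open>Suc n choose 2\<close>.\<close>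

lemma reversal_power: "w \<in> ext_power p \<Longrightarrow> reversal w = (-1) ^ (p choose 2) *\<^sub>R w"
proof (induction rule: ext_power_induct)
  case (gen xs)
  have "reversal (prod_list (map ext_inc xs)) = (-1) ^ (length xs choose 2) *\<^sub>R prod_list (map ext_inc xs)"
  proof (induction xs)
    case (Cons y ys)
    have "ext_inc y * prod_list (map ext_inc ys)
        = (-1) ^ length ys * (prod_list (map ext_inc ys) * ext_inc y)"
      by (intro ext_inc_commute_power prod_mem_power) simp
    then have "prod_list (map ext_inc ys) * ext_inc y
        = (-1) ^ length ys *\<^sub>R (ext_inc y * prod_list (map ext_inc ys))"
      by (cases "even (length ys)") simp_all
    moreover have "Suc (length ys) choose 2 = length ys + (length ys choose 2)"
      by (simp add: numeral_2_eq_2)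
    ultimately show ?case by (simp add: reversal_simps Cons power_add)
  qed (simp add: reversal_simps binomial_eq_0)
  then show ?case using gen by simp
qed (simp_all add: reversal_simps algebra_simps)

section \<open>Grading and finite dimensionality\<close>

lemma ext_power_0_scalar:
  assumes "w \<in> ext_power 0"
  shows "w = scalar_part w *\<^sub>R 1"
  using assms
proof (induction rule: ext_power_induct)
  case (scale c w)
  from arg_cong[OF this, of "(*\<^sub>R) c"] show ?case by (simp add: scalar_part_simps)
qed (simp_all add: scalar_part_simps algebra_simps)

text \<open>Allowing every sufficiently large length \<open>N\<close> lets the decompositions of two
  summands be added at a common length.\<close>

lemma homogeneous_decomposition:
  "\<exists>n. \<forall>N\<ge>n. \<exists>f. (\<forall>p. f p \<in> ext_power p) \<and> w = (\<Sum>p<N. f p)"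
proof (induction w rule: exterior_induct_hom)
  case (add v w)
  then obtain a b where
    a: "\<forall>N\<ge>a. \<exists>f. (\<forall>p. f p \<in> ext_power p) \<and> v = (\<Sum>p<N. f p)" and
    b: "\<forall>N\<ge>b. \<exists>f. (\<forall>p. f p \<in> ext_power p) \<and> w = (\<Sum>p<N. f p)" by blast
  show ?case
  proof (intro exI[of _ "max a b"] allI impI)
    fix N assume "max a b \<le> N"
    then obtain f g where "\<forall>p. f p \<in> ext_power p" "v = (\<Sum>p<N. f p)"
      "\<forall>p. g p \<in> ext_power p" "w = (\<Sum>p<N. g p)" using a b by (metis max.bounded_iff)
    then show "\<exists>f. (\<forall>p. f p \<in> ext_power p) \<and> v + w = (\<Sum>p<N. f p)"
      by (intro exI[of _ "\<lambda>p. f p + g p"]) (simp add: sum.distrib subspace_add subspace_ext_power)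
  qed
next
  case (hom q w)
  then show ?case
    by (intro exI[of _ "Suc q"] allI impI exI[of _ "\<lambda>p. if p = q then w else 0"])
       (auto simp: subspace_0 subspace_ext_power)
qed

lemma ext_inc_mult_prod_mem: "x \<in> set xs \<Longrightarrow> ext_inc x * prod_list (map ext_inc xs) = 0"
proof (induction xs)
  case (Cons y ys)
  have "ext_inc x * (ext_inc y * prod_list (map ext_inc ys))
      = - (ext_inc y * (ext_inc x * prod_list (map ext_inc ys)))"
    using arg_cong[OF ext_inc_anticommute[of x y], of "\<lambda>u. u * prod_list (map ext_inc ys)"]
    by (simp add: mult.assoc)
  moreover have "ext_inc x * (ext_inc x * prod_list (map ext_inc ys)) = 0"
    by (simp add: ext_inc_square flip: mult.assoc)
  ultimately show ?case using Cons by (cases "x = y") auto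
qed simp

text \<open>Generators are adjoined one at a time. As \<open>b j\<close> anticommutes with the
  others and squares to zero, adding the multiples \<open>b j * S\<close> to \<open>S\<close> keeps
  the span closed under the earlier generators and closes it under \<open>b j\<close>.\<close>

lemma exterior_finite_dimensional:
  fixes b :: "'i \<Rightarrow> 'v::real_vector"
  assumes "finite I" "span (b ` I) = UNIV"
  shows "\<exists>S. finite S \<and> span S = (UNIV :: 'v exterior set)"
proof -
  have "\<exists>S. finite S \<and> 1 \<in> span S \<and> (\<forall>i\<in>I. \<forall>w\<in>span S. ext_inc (b i) * w \<in> span S)"
    using assms(1)
  proof (induction I rule: finite_induct)
    case empty
    show ?case by (intro exI[of _ "{1}"]) (simp add: span_base)
  next
    case (insert j I)
    then obtain S where S: "finite S" "1 \<in> span S" "\<And>i w. i \<in> I \<Longrightarrow> w \<in> span S \<Longrightarrow> ext_inc (b i) * w \<in> span S"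
      by blast
    let ?j = "\<lambda>w. ext_inc (b j) * w"
    have lin: "linear (\<lambda>w. ext_inc x * w)" for x :: 'v by (simp add: linear_iff distrib_left)
    have span: "span (S \<union> ?j ` S) = {v + ?j w | v w. v \<in> span S \<and> w \<in> span S}"
      by (auto simp: span_Un linear_span_image[OF lin])
    have swap: "ext_inc x * (ext_inc y * w) = - (ext_inc y * (ext_inc x * w))" for x y :: 'v and w
      using arg_cong[OF ext_inc_anticommute[of x y], of "\<lambda>u. u * w"] by (simp add: mult.assoc)
    have "ext_inc (b i) * u \<in> span (S \<union> ?j ` S)" if i: "i \<in> insert j I" and u: "u \<in> span (S \<union> ?j ` S)" for i u
    proof -
      obtain v w where u: "u = v + ?j w" and vw: "v \<in> span S" "w \<in> span S" using u span by auto
      show ?thesis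
      proof (cases "i = j")
        case True
        then have "ext_inc (b i) * u = 0 + ?j v"
          by (simp add: u distrib_left ext_inc_square flip: mult.assoc)
        then show ?thesis unfolding span using vw span_zero by blast
      next
        case False
        then have "ext_inc (b i) * u = ext_inc (b i) * v + ?j (- (ext_inc (b i) * w))"
          by (simp add: u distrib_left swap[of "b i"])
        moreover have "ext_inc (b i) * v \<in> span S" "- (ext_inc (b i) * w) \<in> span S"
          using S(3) i False vw by (simp_all add: span_neg)
        ultimately show ?thesis unfolding span by blast
      qed
    qed
    moreover have "1 \<in> span (S \<union> ?j ` S)" using S(2) span_mono[of S "S \<union> ?j ` S"] by blast
    ultimately show ?case using S(1) by (intro exI[of _ "S \<union> ?j ` S"]) auto
  qed
  then obtain S where S: "finite S" "1 \<in> span S" "\<And>i w. i \<in> I \<Longrightarrow> w \<in> span S \<Longrightarrow> ext_inc (b i) * w \<in> span S"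
    by blast
  have mult: "ext_inc x * w \<in> span S" if "w \<in> span S" for x w
  proof -
    have "x \<in> span (b ` I)" using assms(2) by simp
    then show ?thesis
    proof (induction rule: span_induct_alt)
      case base
      then show ?case by (simp add: linear_0[OF linear_ext_inc] span_zero)
    next
      case (step c v u)
      then show ?case using S(3) that
        by (auto simp: ext_inc_add ext_inc_scale distrib_right intro!: span_add span_scale)
    qed
  qed
  have "w \<in> span S" for w
    by (induction w rule: exterior_induct) (simp_all add: S(2) mult span_add span_scale)
  then show ?thesis using S(1) by blast
qed

section \<open>Contractions and the inner product on the exterior algebra\<close>

locale orthonormal_form =
  fixes B :: "'v::real_vector \<Rightarrow> 'v \<Rightarrow> real" and m :: nat and e :: "nat \<Rightarrow> 'v"
  assumes bilinear_B: "bilinear B" and basis: "orthonormal_basis B m e"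
begin

definition contract :: "'v \<Rightarrow> 'v exterior \<Rightarrow> 'v exterior"
  where "contract x = poisson_bracket B (ext_inc x)"

lemma bracket: "is_poisson_bracket B (poisson_bracket B)"
  by (rule poisson_bracket[OF bilinear_B basis])

lemma bilinear_bracket: "bilinear (poisson_bracket B)"
  using bracket by (simp add: is_poisson_bracket_def)

lemma linear_bracket: "linear (poisson_bracket B v)" "linear (\<lambda>v. poisson_bracket B v w)"
  using bilinear_bracket by (auto simp: bilinear_def)

lemma bracket_scalar: "poisson_bracket B w (of_real c) = 0"
  using bracket by (simp add: is_poisson_bracket_def)

lemma bracket_ext_inc: "poisson_bracket B (ext_inc x) (ext_inc y) = of_real (B x y)"
  using bracket by (simp add: is_poisson_bracket_def)

lemma bracket_leibniz:
  assumes "v \<in> ext_power p"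
  shows "poisson_bracket B v (ext_inc x * w)
    = poisson_bracket B v (ext_inc x) * w + (-1) ^ p * ext_inc x * poisson_bracket B v w"
  using bracket assms ext_inc_mem_power[of x] unfolding is_poisson_bracket_def
  by (metis mult.right_neutral)

lemma bracket_skew:
  assumes "v \<in> ext_power p"
  shows "poisson_bracket B v (ext_inc x) = - ((-1) ^ p * contract x v)"
  using bracket assms ext_inc_mem_power[of x] unfolding is_poisson_bracket_def contract_def
  by (metis mult.right_neutral)

lemma B_expand: "B x y = (\<Sum>i=1..m. B (e i) x * B (e i) y)"
  by (rule orthonormal_basis_expand[OF bilinear_B basis])

lemma B_commute: "B x y = B y x"
  by (simp add: B_expand[of x y] B_expand[of y x] mult.commute)

lemma linear_B: "linear (B x)" "linear (\<lambda>x. B x y)"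
  using bilinear_B by (auto simp: bilinear_def)

lemma basis_expand: "x = (\<Sum>i=1..m. B (e i) x *\<^sub>R e i)"
proof -
  have "x \<in> span (e ` {1..m})" using basis by (simp add: orthonormal_basis_def)
  then show ?thesis
  proof (induction rule: span_induct_alt)
    case base
    then show ?case by (simp add: linear_0[OF linear_B(1)])
  next
    case (step c v w)
    then obtain j where j: "v = e j" "j \<in> {1..m}" by blast
    have "(\<Sum>i=1..m. B (e i) v *\<^sub>R e i) = (\<Sum>i=1..m. if i = j then v else 0)"
      using basis j by (intro sum.cong) (auto simp: orthonormal_basis_def)
    also have "\<dots> = v" using j by simp
    finally show ?case using step
      by (simp add: linear_add[OF linear_B(1)] linear_cmul[OF linear_B(1)] scaleR_add_left sum.distrib
          flip: scaleR_scaleR scaleR_sum_right)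
  qed
qed

text \<open>Collapses the basis sums that the explicit bracket formula produces.\<close>

lemma linear_basis_expand:
  assumes "linear f"
  shows "(\<Sum>i=1..m. B (e i) x *\<^sub>R f (e i)) = f x"
  by (subst (2) basis_expand[of x]) (simp add: linear_sum[OF assms] linear_cmul[OF assms])

lemma linear_contract: "linear (contract x)" "linear (\<lambda>x. contract x w)"
  by (simp_all add: contract_def linear_bracket linear_iff ext_inc_add ext_inc_scale
      linear_add[OF linear_bracket(2)] linear_cmul[OF linear_bracket(2)]
      linear_add[OF linear_bracket(1)] linear_cmul[OF linear_bracket(1)])

lemma contract_1: "contract x 1 = 0"
  using bracket_scalar[of "ext_inc x" 1] by (simp add: contract_def)

lemma contract_mult: "contract x (ext_inc y * w) = B x y *\<^sub>R w - ext_inc y * contract x w"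
  using bracket_leibniz[OF ext_inc_mem_power[of x], of y w]
  by (simp add: contract_def bracket_ext_inc of_real_def)

lemmas contract_simps = contract_1 contract_mult linear_add[OF linear_contract(1)]
  linear_diff[OF linear_contract(1)] linear_neg[OF linear_contract(1)]
  linear_cmul[OF linear_contract(1)] linear_0[OF linear_contract(1)]
  linear_sum[OF linear_contract(1)]

lemma contract_anticommute: "contract x (contract y w) = - contract y (contract x w)"
  by (induction w rule: exterior_induct) (simp_all add: contract_simps algebra_simps)

lemma contract_square: "contract x (contract x w) = 0"
  using contract_anticommute[of x x w] by (simp add: eq_neg_iff_add_eq_0 flip: scaleR_2)

lemma contract_power: "w \<in> ext_power (Suc p) \<Longrightarrow> contract x w \<in> ext_power p"
proof (induction rule: ext_power_induct)
  case (gen xs)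
  then show ?case
  proof (induction xs arbitrary: p)
    case (Cons y ys)
    have "ext_inc y * contract x (prod_list (map ext_inc ys)) \<in> ext_power p"
    proof (cases p)
      case 0
      then show ?thesis
        using Cons.prems by (simp add: contract_1 subspace_0 subspace_ext_power)
    next
      case (Suc q)
      then show ?thesis using Cons.IH[of q] Cons.prems by (simp add: ext_inc_mult_power)
    qed
    moreover have "B x y *\<^sub>R prod_list (map ext_inc ys) \<in> ext_power p"
      using Cons.prems prod_mem_power[of ys p] by (simp add: subspace_scale subspace_ext_power)
    ultimately show ?case by (simp add: contract_mult subspace_diff subspace_ext_power)
  qed simp
qed (simp_all add: contract_simps subspace_0 subspace_add subspace_scale subspace_ext_power)

lemma contract_scalar: "w \<in> ext_power 0 \<Longrightarrow> contract x w = 0"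
  using ext_power_0_scalar[of w] contract_simps(1,6) by (metis scaleR_zero_right)

text \<open>Contractions square to zero, so the exterior algebra acts on itself with
  \<open>x1 ... xp\<close> acting by successive contractions. The star is this action on the volume
  element.\<close>

definition contract_all :: "'v exterior \<Rightarrow> 'v exterior \<Rightarrow> 'v exterior" where
  "contract_all = (SOME F. bilinear F \<and> (\<forall>b. F 1 b = b) \<and>
    (\<forall>x w b. F (ext_inc x * w) b = contract x (F w b)))"

lemma contract_all:
  "bilinear contract_all" "contract_all 1 b = b"
  "contract_all (ext_inc x * w) b = contract x (contract_all w b)"
proof -
  interpret ext_action contract
    by (rule ext_action.intro[OF linear_contract(2) linear_contract(1) contract_square])
  from someI_ex[OF ext_act_exists, folded contract_all_def] show "bilinear contract_all" "contract_all 1 b = b"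
    "contract_all (ext_inc x * w) b = contract x (contract_all w b)" by blast+
qed

lemma linear_contract_all: "linear (contract_all w)" "linear (\<lambda>w. contract_all w b)"
  using contract_all(1) by (auto simp: bilinear_def)

lemmas contract_all_simps = contract_all(2,3)
  linear_add[OF linear_contract_all(1)] linear_add[OF linear_contract_all(2)]
  linear_diff[OF linear_contract_all(1)] linear_diff[OF linear_contract_all(2)]
  linear_neg[OF linear_contract_all(1)] linear_neg[OF linear_contract_all(2)]
  linear_cmul[OF linear_contract_all(1)] linear_cmul[OF linear_contract_all(2)]
  linear_0[OF linear_contract_all(1)] linear_0[OF linear_contract_all(2)]

lemma contract_all_mult: "contract_all (v * w) b = contract_all v (contract_all w b)"
  by (induction v rule: exterior_induct)
     (simp_all add: contract_all_simps distrib_right mult.assoc)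

lemma contract_all_ext_inc: "contract_all (ext_inc x) b = contract x b"
  using contract_all(3)[of x 1 b] by (simp add: contract_all(2))

text \<open>On two products of equally many vectors this is the Gram determinant of
  \<open>B\<close>. Reversing \<open>v\<close> lets its first factor contract first, so that
  multiplication by \<open>x\<close> has adjoint \<open>contract x\<close>.\<close>

definition ip :: "'v exterior \<Rightarrow> 'v exterior \<Rightarrow> real"
  where "ip v w = scalar_part (contract_all (reversal v) w)"

lemma bilinear_ip: "bilinear ip"
  by (simp add: bilinear_def linear_iff ip_def scalar_part_simps contract_all_simps reversal_simps)

lemma linear_ip: "linear (ip v)" "linear (\<lambda>v. ip v w)"
  using bilinear_ip by (auto simp: bilinear_def)

lemmas ip_simps = linear_add[OF linear_ip(1)] linear_add[OF linear_ip(2)]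
  linear_diff[OF linear_ip(1)] linear_diff[OF linear_ip(2)]
  linear_cmul[OF linear_ip(1)] linear_cmul[OF linear_ip(2)]
  linear_0[OF linear_ip(1)] linear_0[OF linear_ip(2)]
  linear_sum[OF linear_ip(1)] linear_sum[OF linear_ip(2)]

lemma ip_mult_left: "ip (a * v) w = ip v (contract_all (reversal a) w)"
  by (simp add: ip_def reversal_mult contract_all_mult)

lemma ip_ext_inc_left: "ip (ext_inc x * v) w = ip v (contract x w)"
  by (simp add: ip_def reversal_simps contract_all_mult contract_all_ext_inc)

lemma ip_1_left: "ip 1 w = scalar_part w"
  by (simp add: ip_def reversal_simps contract_all_simps)

text \<open>Proved by its own induction, because the symmetry of \<open>ip\<close> is deduced from
  it together with \<open>ip_ext_inc_left\<close>.\<close>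

lemma ip_contract_left: "ip (contract x w) v = ip w (ext_inc x * v)"
proof (induction w arbitrary: v rule: exterior_induct)
  case (mult y w)
  then show ?case
    by (simp add: contract_simps ip_simps ip_ext_inc_left B_commute[of x y])
qed (simp_all add: contract_simps ip_simps ip_1_left scalar_part_simps)

lemma ip_commute: "ip v w = ip w v"
proof (induction v arbitrary: w rule: exterior_induct)
  case one
  show ?case
    by (induction w rule: exterior_induct)
       (simp_all add: ip_1_left scalar_part_simps ip_simps ip_ext_inc_left contract_simps)
next
  case (mult x v)
  then show ?case by (simp add: ip_ext_inc_left ip_contract_left)
qed (simp_all add: ip_simps)

text \<open>Moving \<open>ext_inc x\<close> past each \<open>ext_inc (e i)\<close> leaves the terms
  with \<open>B (e i) x\<close>, which sum to one further copy of the product.\<close>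

lemma number_operator:
  assumes "w \<in> ext_power p"
  shows "(\<Sum>i=1..m. ext_inc (e i) * contract (e i) w) = real p *\<^sub>R w"
  using assms
proof (induction rule: ext_power_induct)
  case (gen xs)
  have "(\<Sum>i=1..m. ext_inc (e i) * contract (e i) (prod_list (map ext_inc xs)))
      = real (length xs) *\<^sub>R prod_list (map ext_inc xs)"
  proof (induction xs)
    case (Cons x xs)
    let ?w = "prod_list (map ext_inc xs)"
    have "ext_inc (e i) * (ext_inc x * u) = - (ext_inc x * (ext_inc (e i) * u))" for i u
      using arg_cong[OF ext_inc_anticommute[of "e i" x], of "\<lambda>v. v * u"] by (simp add: mult.assoc)
    then have "(\<Sum>i=1..m. ext_inc (e i) * contract (e i) (ext_inc x * ?w))
        = (\<Sum>i=1..m. B (e i) x *\<^sub>R (ext_inc (e i) * ?w)) + ext_inc x * (\<Sum>i=1..m. ext_inc (e i) * contract (e i) ?w)"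
      by (simp add: contract_mult right_diff_distrib sum.distrib sum_distrib_left)
    also have "(\<Sum>i=1..m. B (e i) x *\<^sub>R (ext_inc (e i) * ?w)) = ext_inc x * ?w"
      by (rule linear_basis_expand) (simp add: linear_iff ext_inc_add ext_inc_scale distrib_right)
    finally show ?case unfolding Cons by (simp add: scaleR_add_left)
  qed (simp add: contract_simps)
  then show ?case using gen by simp
qed (simp_all add: contract_simps distrib_left sum.distrib scaleR_add_right flip: scaleR_sum_right)

text \<open>The number operator is self-adjoint, with eigenvalues \<open>p\<close> on
  \<open>v\<close> and \<open>q\<close> on \<open>w\<close>.\<close>

lemma ip_different_degrees:
  assumes "v \<in> ext_power p" "w \<in> ext_power q" "p \<noteq> q"
  shows "ip v w = 0"
proof -
  have "real p * ip v w = (\<Sum>i=1..m. ip (ext_inc (e i) * contract (e i) v) w)"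
    using arg_cong[OF number_operator[OF assms(1)], of "\<lambda>u. ip u w"] by (simp add: ip_simps)
  also have "\<dots> = (\<Sum>i=1..m. ip v (ext_inc (e i) * contract (e i) w))"
    by (simp add: ip_ext_inc_left ip_contract_left)
  also have "\<dots> = real q * ip v w"
    using arg_cong[OF number_operator[OF assms(2)], of "ip v"] by (simp add: ip_simps)
  finally show ?thesis using assms(3) by simp
qed

text \<open>Pairing the number operator with \<open>w\<close> expresses \<open>ip w w\<close>, times
  the degree, as the sum of the norms of the contractions \<open>contract (e i) w\<close>, which
  have lower degree.\<close>

lemma ip_pos_homogeneous: "w \<in> ext_power p \<Longrightarrow> 0 \<le> ip w w \<and> (ip w w = 0 \<longrightarrow> w = 0)"
proof (induction p arbitrary: w)
  case 0
  define c where "c = scalar_part w"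
  have "w = c *\<^sub>R 1" using ext_power_0_scalar[OF 0] by (simp add: c_def)
  then show ?case by (simp add: ip_simps ip_1_left scalar_part_simps)
next
  case (Suc p)
  have IH: "0 \<le> ip (contract (e i) w) (contract (e i) w)"
    "ip (contract (e i) w) (contract (e i) w) = 0 \<Longrightarrow> contract (e i) w = 0" for i
    using Suc.IH contract_power[OF Suc.prems] by blast+
  have eq: "real (Suc p) * ip w w = (\<Sum>i=1..m. ip (contract (e i) w) (contract (e i) w))"
    using arg_cong[OF number_operator[OF Suc.prems], of "\<lambda>u. ip u w"]
    by (simp add: ip_simps ip_ext_inc_left)
  then have "0 \<le> real (Suc p) * ip w w" using IH by (simp add: sum_nonneg)
  then have "0 \<le> ip w w" by (simp add: zero_le_mult_iff)
  moreover have "w = 0" if "ip w w = 0"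
  proof -
    have "\<forall>i\<in>{1..m}. contract (e i) w = 0"
      using eq that IH by (simp add: sum_nonneg_eq_0_iff)
    then have "real (Suc p) *\<^sub>R w = 0" using number_operator[OF Suc.prems] by simp
    then show ?thesis by simp
  qed
  ultimately show ?case by blast
qed

lemma ip_pos:
  assumes "w \<noteq> 0"
  shows "0 < ip w w"
proof -
  obtain N f where f: "\<forall>p. f p \<in> ext_power p" "w = (\<Sum>p<N. f p)"
    using homogeneous_decomposition[of w] by blast
  have orthogonal: "ip (f p) (f q) = 0" if "p \<noteq> q" for p q
    using f(1) that ip_different_degrees by blast
  have "ip (f p) w = ip (f p) (f p)" if "p < N" for p
  proof -
    have "ip (f p) w = (\<Sum>q<N. if q = p then ip (f p) (f p) else 0)"
      unfolding f(2) ip_simps by (intro sum.cong) (auto simp: orthogonal)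
    then show ?thesis using that by simp
  qed
  then have eq: "ip w w = (\<Sum>p<N. ip (f p) (f p))"
    by (subst f(2)) (simp add: ip_simps)
  have nonneg: "\<forall>p. 0 \<le> ip (f p) (f p)" using f(1) ip_pos_homogeneous by blast
  obtain p where "p < N" "f p \<noteq> 0" using assms f(2) by (metis lessThan_iff sum.neutral)
  then have "0 < ip (f p) (f p)" using f(1) ip_pos_homogeneous[of "f p" p] by fastforce
  then show ?thesis unfolding eq using nonneg \<open>p < N\<close> by (intro sum_pos2[of _ p]) auto
qed

sublocale inner_form ip
  by standard (fact bilinear_ip ip_commute ip_pos)+

end

section \<open>The star operator and the adjoint of an odd bracket\<close>

lemma ext_odd_induct [consumes 1, case_names zero add]:
  assumes "w \<in> ext_odd" "P 0"
    "\<And>p v w. odd p \<Longrightarrow> v \<in> ext_power p \<Longrightarrow> P w \<Longrightarrow> P (v + w)"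
  shows "P w"
  using assms(1) unfolding ext_odd_def
proof (induction rule: span_induct_alt)
  case (step c v w)
  then show ?case using assms(3) subspace_scale[OF subspace_ext_power] by blast
qed (rule assms(2))

context orthonormal_form
begin

abbreviation star :: "'v exterior \<Rightarrow> 'v exterior"
  where "star \<equiv> hodge_star B m e"

lemma star_eq_contract_all: "star w = contract_all w (ext_volume m e)"
proof -
  have "contract_all (prod_list (map ext_inc xs)) b = foldr (\<lambda>x. poisson_bracket B (ext_inc x)) xs b" for xs b
    by (induction xs) (simp_all add: contract_all_simps contract_def)
  then have "is_hodge_star B m e (\<lambda>w. contract_all w (ext_volume m e))"
    by (simp add: is_hodge_star_def linear_contract_all)
  then have "star = (\<lambda>w. contract_all w (ext_volume m e))"
    by (rule is_hodge_star_unique[OF hodge_star[OF bilinear_B basis]])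
  then show ?thesis by simp
qed

lemma linear_star: "linear star"
  using hodge_star[OF bilinear_B basis] by (simp add: is_hodge_star_def)

lemmas star_simps = linear_add[OF linear_star] linear_diff[OF linear_star]
  linear_cmul[OF linear_star] linear_0[OF linear_star] linear_sum[OF linear_star]

lemma star_mult: "star (v * w) = contract_all v (star w)"
  by (simp add: star_eq_contract_all contract_all_mult)

lemma star_ext_inc_mult: "star (ext_inc x * w) = contract x (star w)"
  by (simp add: star_mult contract_all_ext_inc)

lemma star_1: "star 1 = ext_volume m e"
  by (simp add: star_eq_contract_all contract_all_simps)

lemma ext_volume_eq: "ext_volume m e = prod_list (map ext_inc (map e [1..<Suc m]))"
  by (simp add: ext_volume_def o_def)

lemma ext_volume_power: "ext_volume m e \<in> ext_power m"
  unfolding ext_volume_eq by (rule prod_mem_power) simp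

text \<open>After expanding \<open>x\<close> in the basis, every term repeats a factor of the volume
  element.\<close>

lemma ext_inc_mult_volume: "ext_inc x * ext_volume m e = 0"
proof -
  have "linear (\<lambda>x. ext_inc x * ext_volume m e)"
    by (simp add: linear_iff ext_inc_add ext_inc_scale distrib_right)
  from linear_basis_expand[OF this, of x]
  have "ext_inc x * ext_volume m e = (\<Sum>i=1..m. B (e i) x *\<^sub>R (ext_inc (e i) * ext_volume m e))" by simp
  also have "\<dots> = 0"
  proof (intro sum.neutral ballI)
    fix i assume "i \<in> {1..m}"
    then have "e i \<in> set (map e [1..<Suc m])" by (simp del: upt_Suc)
    then show "B (e i) x *\<^sub>R (ext_inc (e i) * ext_volume m e) = 0"
      unfolding ext_volume_eq by (simp only: ext_inc_mult_prod_mem scaleR_zero_right)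
  qed
  finally show ?thesis .
qed

text \<open>Both sides obey the same recursion in \<open>w\<close>. At \<open>w = 1\<close> both
  vanish, the right one because \<open>ext_inc x\<close> annihilates the volume element.\<close>

lemma star_contract: "star (contract x w) = ext_inc x * star w"
proof (induction w rule: exterior_induct)
  case (mult y w)
  then show ?case
    by (simp add: contract_simps star_simps star_ext_inc_mult B_commute[of x y])
qed (simp_all add: contract_simps star_simps star_1 ext_inc_mult_volume distrib_left)

lemma contract_all_power:
  assumes "v \<in> ext_power p" "w \<in> ext_power (p + q)"
  shows "contract_all v w \<in> ext_power q"
  using assms(1)
proof (induction rule: ext_power_induct)
  case (gen xs)
  have "contract_all (prod_list (map ext_inc xs)) w \<in> ext_power r" if "w \<in> ext_power (length xs + r)" for r
    using that by (induction xs arbitrary: r) (simp_all add: contract_all_simps contract_power)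
  then show ?case using gen assms(2) by blast
qed (simp_all add: contract_all_simps subspace_0 subspace_add subspace_scale subspace_ext_power)

lemma contract_orthogonal_prod:
  assumes "j \<in> {1..m}" "set is \<subseteq> {1..m} - {j}"
  shows "contract (e j) (prod_list (map ext_inc (map e is))) = 0"
  using assms(2)
proof (induction "is")
  case (Cons i "is")
  have "B (e j) (e i) = 0" using Cons.prems assms(1) basis by (auto simp: orthonormal_basis_def)
  then show ?case using Cons by (simp add: contract_simps)
qed (simp add: contract_simps)

lemma ip_orthonormal_prod:
  assumes "distinct is" "set is \<subseteq> {1..m}"
  shows "ip (prod_list (map ext_inc (map e is))) (prod_list (map ext_inc (map e is))) = 1"
  using assms
proof (induction "is")
  case (Cons i "is")
  have "B (e i) (e i) = 1" using Cons.prems basis by (auto simp: orthonormal_basis_def)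
  moreover have "contract (e i) (prod_list (map ext_inc (map e is))) = 0"
    using Cons.prems by (intro contract_orthogonal_prod) auto
  ultimately show ?case using Cons by (simp add: ip_ext_inc_left contract_simps)
qed (simp add: ip_1_left scalar_part_simps)

text \<open>The double star commutes with multiplication by vectors, so it is determined by its
  value at \<open>1\<close>, the star of the volume element, which has degree 0.\<close>

lemma star_star: "\<exists>c. c \<noteq> 0 \<and> (\<forall>w. star (star w) = c *\<^sub>R w)"
proof -
  let ?L = "ext_volume m e"
  define c where "c = scalar_part (star ?L)"
  have "star ?L \<in> ext_power 0"
    unfolding star_eq_contract_all using ext_volume_power by (intro contract_all_power[of _ m]) simp_all
  then have c: "star ?L = c *\<^sub>R 1" unfolding c_def by (rule ext_power_0_scalar)
  have "star (star w) = c *\<^sub>R w" for w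
    by (induction w rule: exterior_induct)
       (simp_all add: star_1 c star_simps star_ext_inc_mult star_contract scaleR_add_right)
  \<comment> \<open>Up to the reversal sign, the norm of the volume element is the same scalar
    \<open>c\<close>; as the norm is 1, \<open>c\<close> is nonzero.\<close>
  moreover have "ip ?L ?L = (-1) ^ (m choose 2) * c"
    unfolding c_def star_eq_contract_all ip_def reversal_power[OF ext_volume_power]
    by (simp add: contract_all_simps scalar_part_simps)
  moreover have "ip ?L ?L = 1"
    unfolding ext_volume_eq by (rule ip_orthonormal_prod) auto
  ultimately show ?thesis by (intro exI[of _ c]) auto
qed

section \<open>Brackets with odd elements\<close>

lemma contract_derivation:
  assumes "v \<in> ext_power p"
  shows "contract x (v * w) = contract x v * w + (-1) ^ p * v * contract x w"
  using bracket assms ext_inc_mem_power[of x] unfolding is_poisson_bracket_def contract_def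
  by (metis mult_1)

text \<open>Contracting an odd element gives an even one, and even elements commute with
  everything.\<close>

lemma contract_odd_central: "v \<in> ext_odd \<Longrightarrow> w * contract x v = contract x v * w"
proof (induction rule: ext_odd_induct)
  case (add p v v')
  then obtain q where q: "p = Suc q" "even q" by (auto elim: oddE)
  have power: "contract x v \<in> ext_power q" using add q contract_power by blast
  have "w * contract x v = contract x v * w" for w
  proof (induction w rule: exterior_induct_hom)
    case (hom r w)
    then show ?case using q commute_power[OF power hom] by simp
  qed (simp add: algebra_simps)
  then show ?case using add by (simp add: contract_simps algebra_simps)
qed (simp add: contract_simps)

lemma contract_odd_derivation:
  "v \<in> ext_odd \<Longrightarrow> contract x (contract y v * w) = contract x (contract y v) * w + contract y v * contract x w"
proof (induction rule: ext_odd_induct)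
  case (add p v v')
  then obtain q where q: "p = Suc q" "even q" by (auto elim: oddE)
  have "contract y v \<in> ext_power q" using add q contract_power by blast
  then show ?case using add q contract_derivation[of "contract y v" q x w]
    by (simp add: contract_simps distrib_right)
qed (simp add: contract_simps)

text \<open>Both sides satisfy the same Leibniz recursion in \<open>w\<close>. On a vector
  \<open>x\<close>, skew symmetry in odd degree gives \<open>contract x v\<close>, which is also the
  value of the basis sum.\<close>

lemma bracket_odd:
  "v \<in> ext_odd \<Longrightarrow> poisson_bracket B v w = (\<Sum>i=1..m. contract (e i) v * contract (e i) w)"
proof (induction arbitrary: w rule: ext_odd_induct)
  case (add p v v')
  have v: "v \<in> ext_odd" using add unfolding ext_odd_def by (intro span_base) auto
  have "poisson_bracket B v w = (\<Sum>i=1..m. contract (e i) v * contract (e i) w)"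
  proof (induction w rule: exterior_induct)
    case one
    show ?case using bracket_scalar[of v 1] by (simp add: contract_simps)
  next
    case (mult x w)
    have "contract (e i) v * (ext_inc x * u) = ext_inc x * (contract (e i) v * u)" for i u
      using contract_odd_central[OF v, of "ext_inc x" "e i"] by (metis mult.assoc)
    then have "(\<Sum>i=1..m. contract (e i) v * contract (e i) (ext_inc x * w))
        = (\<Sum>i=1..m. B (e i) x *\<^sub>R (contract (e i) v * w))
          - ext_inc x * (\<Sum>i=1..m. contract (e i) v * contract (e i) w)"
      by (simp add: contract_mult right_diff_distrib sum_subtractf sum_distrib_left)
    also have "(\<Sum>i=1..m. B (e i) x *\<^sub>R (contract (e i) v * w)) = contract x v * w"
      by (rule linear_basis_expand)
         (simp add: linear_iff linear_add[OF linear_contract(2)] linear_cmul[OF linear_contract(2)] distrib_right)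
    finally show ?case
      using bracket_leibniz[OF add(2), of x w] bracket_skew[OF add(2), of x] add(1) mult by simp
  qed (simp_all add: linear_add[OF linear_bracket(1)] linear_cmul[OF linear_bracket(1)] contract_simps
      distrib_left sum.distrib flip: scaleR_sum_right)
  then show ?case using add
    by (simp add: linear_add[OF linear_bracket(2)] contract_simps distrib_right sum.distrib)
qed (simp add: linear_0[OF linear_bracket(2)] contract_simps)

text \<open>The defining Leibniz rule is for homogeneous \<open>v\<close>. For inhomogeneous odd
  \<open>v\<close> both rules come from the explicit sum, whose factors
  \<open>contract (e i) v\<close> are central.\<close>

lemma bracket_odd_mult:
  assumes "v \<in> ext_odd"
  shows "poisson_bracket B v (ext_inc x * w) = contract x v * w - ext_inc x * poisson_bracket B v w"
    and "poisson_bracket B v (contract x v * w)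
      = poisson_bracket B v (contract x v) * w + contract x v * poisson_bracket B v w"
proof -
  have swap: "contract (e i) v * (u * w) = u * (contract (e i) v * w)" for i u w
    using contract_odd_central[OF assms, of u "e i"] by (metis mult.assoc)
  have "(\<Sum>i=1..m. B (e i) x *\<^sub>R (contract (e i) v * w)) = contract x v * w"
    by (rule linear_basis_expand)
       (simp add: linear_iff linear_add[OF linear_contract(2)] linear_cmul[OF linear_contract(2)] distrib_right)
  then show "poisson_bracket B v (ext_inc x * w) = contract x v * w - ext_inc x * poisson_bracket B v w"
    by (simp add: bracket_odd[OF assms] contract_mult swap right_diff_distrib sum_subtractf sum_distrib_left)
  show "poisson_bracket B v (contract x v * w)
      = poisson_bracket B v (contract x v) * w + contract x v * poisson_bracket B v w"
    by (simp add: bracket_odd[OF assms] contract_odd_derivation[OF assms] swap[of _ "contract x v"]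
        distrib_left sum.distrib sum_distrib_left sum_distrib_right mult.assoc)
qed

text \<open>Applied twice to \<open>ext_inc x * w\<close>, the Leibniz rule makes the mixed terms
  cancel. What remains contains either the bracket of \<open>v\<close> with
  \<open>contract x v\<close> or the double bracket of \<open>w\<close>.\<close>

lemma bracket_bracket_odd:
  assumes v: "v \<in> ext_odd" and vv: "poisson_bracket B v v \<in> ext_power 0"
  shows "poisson_bracket B v (poisson_bracket B v w) = 0"
proof -
  \<comment> \<open>Contracting the scalar \<open>poisson_bracket B v v\<close> with
    \<open>x\<close> gives \<open>- 2\<close> times this bracket.\<close>
  have 1: "poisson_bracket B v (contract x v) = 0" for x
  proof -
    have "0 = contract x (poisson_bracket B v v)" using contract_scalar[OF vv] by simp
    also have "\<dots> = (\<Sum>i=1..m. 2 *\<^sub>R (contract (e i) v * contract x (contract (e i) v)))"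
      using contract_odd_central[OF v, of "contract x (contract y v)" y for y]
      by (simp add: bracket_odd[OF v] contract_simps contract_odd_derivation[OF v] scaleR_2)
    also have "\<dots> = - 2 *\<^sub>R poisson_bracket B v (contract x v)"
      by (simp add: bracket_odd[OF v] contract_anticommute[of x] sum_negf flip: scaleR_sum_right)
    finally show ?thesis by simp
  qed
  show ?thesis
  proof (induction w rule: exterior_induct)
    case one
    show ?case using bracket_scalar[of v 1] by (simp add: linear_0[OF linear_bracket(1)])
  qed (simp_all add: bracket_odd_mult[OF v] 1 linear_add[OF linear_bracket(1)]
      linear_diff[OF linear_bracket(1)] linear_cmul[OF linear_bracket(1)])
qed

text \<open>Passing one contraction by \<open>y\<close> costs a sign and a term with
  \<open>B x y\<close>; these terms assemble to \<open>contract x v\<close>.\<close>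

lemma ext_inc_mult_contract_all:
  assumes "v \<in> ext_power p"
  shows "ext_inc x * contract_all v w
    = (-1) ^ p *\<^sub>R contract_all v (ext_inc x * w) + contract_all (contract x v) w"
  using assms
proof (induction rule: ext_power_induct)
  case (gen xs)
  have "ext_inc x * contract_all (prod_list (map ext_inc xs)) w
      = (-1) ^ length xs *\<^sub>R contract_all (prod_list (map ext_inc xs)) (ext_inc x * w)
        + contract_all (contract x (prod_list (map ext_inc xs))) w"
  proof (induction xs)
    case (Cons y ys)
    let ?u = "prod_list (map ext_inc ys)"
    have "ext_inc x * contract y (contract_all ?u w)
        = B x y *\<^sub>R contract_all ?u w - contract y (ext_inc x * contract_all ?u w)"
      by (simp add: contract_mult B_commute[of x y])
    also note Cons
    finally show ?case by (simp add: contract_all_simps contract_simps)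
  qed (simp add: contract_all_simps contract_simps)
  then show ?case using gen by simp
qed (simp_all add: contract_all_simps contract_simps algebra_simps)

text \<open>The two stars turn a summand \<open>contract (e i) v * contract (e i) _\<close> of the
  bracket into \<open>c\<close> times multiplication by \<open>e i\<close> followed by contraction
  with \<open>contract (e i) v\<close>. Its adjoint is the original summand up to the reversal sign
  in degree \<open>q\<close>.\<close>

lemma adjoint_bracket:
  assumes v: "v \<in> ext_power (Suc q)" and q: "even q"
    and c: "\<And>w. star (star w) = c *\<^sub>R w"
  shows "ip u (star (poisson_bracket B v (star w)))
    = c * (-1) ^ (q choose 2) * ip (poisson_bracket B v u) w"
proof -
  have odd: "v \<in> ext_odd"
    unfolding ext_odd_def using v q by (intro span_base UN_I[of "Suc q"]) simp_all
  have power: "contract x v \<in> ext_power q" for x using v by (rule contract_power)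
  \<comment> \<open>The correction term contracts \<open>v\<close> twice with \<open>e i\<close> and
    so vanishes; even \<open>q\<close> means no sign.\<close>
  have swap: "contract_all (contract (e i) v) (ext_inc (e i) * w)
      = ext_inc (e i) * contract_all (contract (e i) v) w" for i
    using ext_inc_mult_contract_all[OF power] q
    by (simp add: contract_square contract_all_simps)
  have "star (poisson_bracket B v (star w))
      = (\<Sum>i=1..m. c *\<^sub>R (ext_inc (e i) * contract_all (contract (e i) v) w))"
    by (simp add: bracket_odd[OF odd] star_simps star_mult star_contract c contract_all_simps swap)
  then have "ip u (star (poisson_bracket B v (star w)))
      = (\<Sum>i=1..m. c * ip (contract (e i) u) (contract_all (contract (e i) v) w))"
    by (simp add: ip_simps ip_contract_left)
  also have "\<dots> = (\<Sum>i=1..m. c * (-1) ^ (q choose 2) * ip (contract (e i) v * contract (e i) u) w)"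
    by (intro sum.cong refl)
       (simp add: ip_mult_left reversal_power[OF power] contract_all_simps ip_simps)
  also have "\<dots> = c * (-1) ^ (q choose 2) * ip (poisson_bracket B v u) w"
    by (simp add: bracket_odd[OF odd] ip_simps sum_distrib_left)
  finally show ?thesis .
qed

text \<open>Pairing \<open>f j\<close> with the whole sum gives zero, as the sum is odd, and also
  \<open>ip (f j) (f j)\<close>, as the other components have other degrees.\<close>

lemma even_component_zero:
  fixes f :: "'i \<Rightarrow> 'v exterior"
  assumes "(\<Sum>k\<in>K. f k) \<in> ext_odd" "finite K" "inj_on g K" "\<And>k. k \<in> K \<Longrightarrow> f k \<in> ext_power (g k)"
    and j: "j \<in> K" "even (g j)"
  shows "f j = 0"
proof -
  have "ip (f j) v = 0" if "v \<in> ext_odd" for v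
    using that
  proof (induction rule: ext_odd_induct)
    case (add p v w)
    then show ?case using ip_different_degrees[OF assms(4)[OF j(1)] add(2)] j(2) by (auto simp: ip_simps)
  qed (simp add: ip_simps)
  from this[OF assms(1)] have "0 = (\<Sum>k\<in>K. ip (f j) (f k))" by (simp add: ip_simps)
  also have "\<dots> = (\<Sum>k\<in>K. if k = j then ip (f j) (f j) else 0)"
    using assms(3,4) j(1) by (intro sum.cong) (auto simp: inj_on_def intro!: ip_different_degrees)
  also have "\<dots> = ip (f j) (f j)" using assms(2) j(1) by simp
  finally show ?thesis using ip_eq_0 by simp
qed

end

text \<open>The two exponents have the parities of \<open>1 - j\<close> and \<open>j\<close>, so
  exactly one of them is odd.\<close>

lemma codiff_sign:
  fixes j :: nat
  assumes "k = 2 * int j - 1"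
  shows "((-1) powi (k * (1 - k) div 2)) * (-1) ^ (2 * j choose 2) = (-1 :: real)"
proof -
  have "k * (1 - k) div 2 = (2 * int j - 1) * (1 - int j)"
    unfolding assms by (simp add: algebra_simps)
  moreover have "2 * j choose 2 = j * (2 * j - 1)"
    by (simp add: choose_two)
  moreover have "even (j * (2 * j - 1)) \<longleftrightarrow> even j" by (cases j) auto
  ultimately show ?thesis
    by (cases "even j") (simp_all add: power_int_minus_left)
qed


theorem theorem1:
  fixes B :: "'v::real_vector \<Rightarrow> 'v \<Rightarrow> real" and m :: nat and e :: "nat \<Rightarrow> 'v"
    and \<mu> :: "'v exterior" and \<mu>k :: "int \<Rightarrow> 'v exterior"
  assumes "bilinear B" and "\<forall>x y. B x y = B y x" and "\<forall>x. x \<noteq> 0 \<longrightarrow> B x x > 0"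
    and "orthonormal_basis B m e"
    and "metric_Linf B \<mu>"
    and "\<forall>k\<in>{-2..int m - 2}. \<mu>k k \<in> ext_power (nat (k + 2))"
    and "\<mu> = (\<Sum>k = -2..int m - 2. \<mu>k k)"
  shows "direct_sum3 (range (Linf_d B \<mu>)) (range (Linf_codiff B m e \<mu>k))
           {w. Linf_laplacian B m e \<mu> \<mu>k w = 0}
       \<and> iso_quotient {w. Linf_laplacian B m e \<mu> \<mu>k w = 0}
           {w. Linf_d B \<mu> w = 0} (range (Linf_d B \<mu>))"
proof -
  interpret orthonormal_form B m e using assms(1,4) by unfold_locales
  obtain c where c: "c \<noteq> 0" "\<And>w. star (star w) = c *\<^sub>R w" using star_star by blast
  let ?K = "{-2..int m - 2}"
  have odd: "\<mu> \<in> ext_odd" using assms(5) by (simp add: metric_Linf_def)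
  have lin: "linear (Linf_d B v)" for v by (simp add: Linf_d_def linear_bracket)
  \<comment> \<open>Each summand of the codifferential is \<open>- c\<close> times the adjoint of
    the bracket with \<open>\<mu>k k\<close>; for even \<open>k\<close> both are zero.\<close>
  have component: "((-1) powi (k * (1 - k) div 2)) * ip v (star (Linf_d B (\<mu>k k) (star w)))
      = - c * ip (Linf_d B (\<mu>k k) v) w" if k: "k \<in> ?K" for k v w
  proof (cases "even k")
    case True
    have "\<mu>k k = 0"
      using k True assms(6) odd unfolding assms(7)
      by (intro even_component_zero[of \<mu>k ?K "\<lambda>k. nat (k + 2)"])
         (auto simp: inj_on_def even_nat_iff)
    then show ?thesis
      by (simp add: Linf_d_def linear_0[OF linear_bracket(2)] star_simps ip_simps)
  next
    case False
    \<comment> \<open>Odd \<open>k\<close> makes the division exact and \<open>k \<ge> -2\<close>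
      then forces \<open>k \<ge> -1\<close>, so \<open>k + 2 = 2 * j + 1\<close> with
      \<open>j\<close> natural.\<close>
    define j where "j = nat ((k + 1) div 2)"
    have kj: "k = 2 * int j - 1" using k False by (auto simp: j_def elim!: oddE)
    then have "nat (k + 2) = Suc (2 * j)" by simp
    then have "\<mu>k k \<in> ext_power (Suc (2 * j))" using bspec[OF assms(6) k] by simp
    from adjoint_bracket[OF this _ c(2), of v w]
    have "ip v (star (Linf_d B (\<mu>k k) (star w)))
        = c * (-1) ^ (2 * j choose 2) * ip (Linf_d B (\<mu>k k) v) w"
      by (simp add: Linf_d_def)
    then have "((-1) powi (k * (1 - k) div 2)) * ip v (star (Linf_d B (\<mu>k k) (star w)))
        = c * (((-1) powi (k * (1 - k) div 2)) * (-1) ^ (2 * j choose 2)) * ip (Linf_d B (\<mu>k k) v) w"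
      by (simp only: mult_ac)
    then show ?thesis unfolding codiff_sign[OF kj] by simp
  qed
  interpret hodge_complex ip "Linf_d B \<mu>" "Linf_codiff B m e \<mu>k" "- c"
  proof (intro hodge_complex.intro hodge_complex_axioms.intro inner_form_axioms)
    show "linear (Linf_d B \<mu>)" by (rule lin)
    show "Linf_d B \<mu> (Linf_d B \<mu> w) = 0" for w
      using bracket_bracket_odd[OF odd] assms(5) by (simp add: Linf_d_def metric_Linf_def)
    show "linear (Linf_codiff B m e \<mu>k)"
      unfolding Linf_codiff_def
      by (intro linear_compose_sum ballI linear_compose_scale_right)
         (simp add: linear_iff star_simps linear_add[OF lin] linear_cmul[OF lin])
    show "ip v (Linf_codiff B m e \<mu>k w) = - c * ip (Linf_d B \<mu> v) w" for v w
    proof -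
      have "ip v (Linf_codiff B m e \<mu>k w) = (\<Sum>k\<in>?K. - c * ip (Linf_d B (\<mu>k k) v) w)"
        unfolding Linf_codiff_def ip_simps real_scaleR_def by (intro sum.cong refl component)
      also have "\<dots> = - c * ip (\<Sum>k\<in>?K. Linf_d B (\<mu>k k) v) w"
        by (simp add: ip_simps sum_distrib_left)
      also have "(\<Sum>k\<in>?K. Linf_d B (\<mu>k k) v) = Linf_d B \<mu> v"
        by (simp add: Linf_d_def assms(7) linear_sum[OF linear_bracket(2)])
      finally show ?thesis .
    qed
    show "- c \<noteq> 0" using c by simp
    show "\<exists>S. finite S \<and> span S = (UNIV :: 'v exterior set)"
      using basis by (intro exterior_finite_dimensional[of "{1..m}" e]) (simp_all add: orthonormal_basis_def)
  qed
  show ?thesis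
    unfolding Linf_laplacian_def using direct_sum_decomposition harmonic_iso_cohomology by blast
qed

end
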